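(* Let $\mathcal X=[0,1]^D$, $\delta\in(0,1)$, $\alpha_0>0$, $0<\beta\le1$ and $L\ge3$. Let $\mathcal P(L,\beta,\alpha_0)$ be the class of joint distributions $P_{XY}$ on $\mathcal X\times\{0,1\}$ which satisfy the margin assumption (at the thresholds $1/2\pm\gamma_\delta$) with exponent $\alpha_0$ and whose regression function $\eta$ is $(L,\beta)$ Hölder continuous. In the bounded-rate abstention setting, where for an active learning algorithm $\mathcal A$ we let $\hat g_n$ be the abstaining classifier (with abstention rate at most $\delta$) learned by $\mathcal A$ with $n$ label queries, there is a constant $C>0$, not depending on $n$, such that $$\inf_{\mathcal A}\ \sup_{P_{XY}\in\mathcal P(L,\beta,\alpha_0)}\ \mathbb E\left[R(\hat g_n)-R(g^*_\delta)\right]\ \ge\ C\,n^{-\beta(1+\alpha_0)/(2\beta+D)}.$$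
   Context: For a joint distribution $P_{XY}$ on $\mathcal X\times\{0,1\}$, $P_X$ is the marginal of $X$ and $\eta(x)=P(Y=1\mid X=x)$. A (randomized) abstaining classifier $g$ assigns to each $x\in\mathcal X$ a probability distribution on $\{0,1,\Delta\}$ ($\Delta$ = abstain). Its misclassification risk is $R(g)=P(g(X)\ne Y,\ g(X)\ne\Delta)$. Bounded-rate abstention problem: minimize $R(g)$ over classifiers with $P(g(X)=\Delta)\le\delta$; $g^*_\delta$ denotes a Bayes optimal (minimizing) classifier. Also $\gamma_\delta=\sup\{\gamma\ge0:P_X(|\eta(X)-1/2|\le\gamma)\le\delta\}$. Margin assumption with exponent $\alpha_0$: there is $C_0>0$ with $P_X(|\eta(X)-\gamma|\le t)\le C_0t^{\alpha_0}$ for all $0<t\le1$ and $\gamma\in\{1/2-\gamma_\delta,1/2+\gamma_\delta\}$. $(L,\beta)$ Hölder continuity: $|\eta(x_1)-\eta(x_2)|\le L\|x_1-x_2\|_2^\beta$ for all $x_1,x_2\in\mathcal X$. An active learning algorithm (membership query model) with $n$ label queries sequentially chooses query points $X_1,\dots,X_n\in\mathcal X$, where $X_t$ may depend on $(X_s,Y_s)_{s<t}$ (and internal randomness), observes $Y_t\sim\mathrm{Bernoulli}(\eta(X_t))$ (conditionally independent of the past given $X_t$), and outputs a classifier $\hat g_n$ which is feasible for the bounded-rate problem, i.e. abstains with probability at most $\delta$ under $P_X$. The expectation is over the data and the algorithm's randomness. *)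

theory Defs
  imports "HOL-Probability.Probability"
begin

abbreviation unit_cube :: "(real ^ 'd) set" where
  "unit_cube \<equiv> cbox 0 1"

abbreviation cube_space :: "(real ^ 'd) measure" where
  "cube_space \<equiv> restrict_space borel unit_cube"

abbreviation labelled_space :: "((real ^ 'd) \<times> bool) measure" where
  "labelled_space \<equiv> cube_space \<Otimes>\<^sub>M count_space UNIV"

text \<open>Labels $0,1$ are \<^term>\<open>False\<close> and \<^term>\<open>True\<close>.\<close>

definition joint_distribution :: "((real ^ 'd) \<times> bool) measure \<Rightarrow> bool" where
  "joint_distribution P \<longleftrightarrow> prob_space P \<and> sets P = sets labelled_space"

definition marginal :: "((real ^ 'd) \<times> bool) measure \<Rightarrow> (real ^ 'd) measure" where
  "marginal P = distr P cube_space fst"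

text \<open>
  \<open>\<eta>\<close> is a version of $P(Y = 1 \mid X = x)$. The joint law determines it only almost surely, but
  labels may be queried at any point of the cube, so the version is part of the model.
\<close>

definition regression_function ::
    "((real ^ 'd) \<times> bool) measure \<Rightarrow> (real ^ 'd \<Rightarrow> real) \<Rightarrow> bool" where
  "regression_function P \<eta> \<longleftrightarrow>
     \<eta> \<in> borel_measurable cube_space \<and> (\<forall>x\<in>unit_cube. 0 \<le> \<eta> x \<and> \<eta> x \<le> 1) \<and>
     (AE z in P. \<eta> (fst z) =
        real_cond_exp P (vimage_algebra (space P) fst cube_space) (\<lambda>(x, y). of_bool y) z)"

definition hoelder_on_cube :: "real \<Rightarrow> real \<Rightarrow> (real ^ 'd \<Rightarrow> real) \<Rightarrow> bool" where
  "hoelder_on_cube L \<beta> \<eta> \<longleftrightarrow>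
     (\<forall>x1\<in>unit_cube. \<forall>x2\<in>unit_cube. \<bar>\<eta> x1 - \<eta> x2\<bar> \<le> L * norm (x1 - x2) powr \<beta>)"

text \<open>
  The supremum is taken in $[0,\infty)$, whence the added \<open>0\<close>: it only matters when the set is
  empty, i.e. when $P_X(\eta = 1/2) > \delta$, as \<^term>\<open>Sup {} :: real\<close> is unspecified.
\<close>

definition abstention_threshold ::
    "real \<Rightarrow> (real ^ 'd) measure \<Rightarrow> (real ^ 'd \<Rightarrow> real) \<Rightarrow> real" where
  "abstention_threshold \<delta> \<mu> \<eta> =
     Sup (insert 0 {\<gamma>. 0 \<le> \<gamma> \<and> measure \<mu> {x \<in> space \<mu>. \<bar>\<eta> x - 1/2\<bar> \<le> \<gamma>} \<le> \<delta>})"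

definition margin_assumption ::
    "real \<Rightarrow> real \<Rightarrow> (real ^ 'd) measure \<Rightarrow> (real ^ 'd \<Rightarrow> real) \<Rightarrow> bool" where
  "margin_assumption \<alpha>\<^sub>0 \<delta> \<mu> \<eta> \<longleftrightarrow>
     (\<exists>C\<^sub>0>0. \<forall>t. 0 < t \<and> t \<le> 1 \<longrightarrow>
        (\<forall>\<gamma>\<in>{1/2 - abstention_threshold \<delta> \<mu> \<eta>, 1/2 + abstention_threshold \<delta> \<mu> \<eta>}.
           measure \<mu> {x \<in> space \<mu>. \<bar>\<eta> x - \<gamma>\<bar> \<le> t} \<le> C\<^sub>0 * t powr \<alpha>\<^sub>0))"

definition model_class ::
    "real \<Rightarrow> real \<Rightarrow> real \<Rightarrow> real \<Rightarrow>
     (((real ^ 'd) \<times> bool) measure \<times> (real ^ 'd \<Rightarrow> real)) set" where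
  "model_class \<delta> L \<beta> \<alpha>\<^sub>0 =
     {(P, \<eta>). joint_distribution P \<and> regression_function P \<eta> \<and>
        hoelder_on_cube L \<beta> \<eta> \<and> margin_assumption \<alpha>\<^sub>0 \<delta> (marginal P) \<eta>}"

text \<open>Randomized classifiers with values in $\{0,1,\Delta\}$; the symbol $\Delta$ is \<^term>\<open>None\<close>.\<close>

type_synonym 'x abstaining_classifier = "'x \<Rightarrow> bool option pmf"

definition measurable_classifier :: "(real ^ 'd) abstaining_classifier \<Rightarrow> bool" where
  "measurable_classifier g \<longleftrightarrow> (\<forall>a. (\<lambda>x. pmf (g x) a) \<in> borel_measurable cube_space)"

definition risk ::
    "((real ^ 'd) \<times> bool) measure \<Rightarrow> (real ^ 'd) abstaining_classifier \<Rightarrow> real" where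
  "risk P g = (\<integral>(x, y). measure_pmf.prob (g x) {a. a \<noteq> Some y \<and> a \<noteq> None} \<partial>P)"

definition abstention_rate ::
    "(real ^ 'd) measure \<Rightarrow> (real ^ 'd) abstaining_classifier \<Rightarrow> real" where
  "abstention_rate \<mu> g = (\<integral>x. pmf (g x) None \<partial>\<mu>)"

definition feasible_classifiers ::
    "real \<Rightarrow> (real ^ 'd) measure \<Rightarrow> (real ^ 'd) abstaining_classifier set" where
  "feasible_classifiers \<delta> \<mu> = {g. measurable_classifier g \<and> abstention_rate \<mu> g \<le> \<delta>}"

definition bayes_classifier ::
    "real \<Rightarrow> ((real ^ 'd) \<times> bool) measure \<Rightarrow> (real ^ 'd) abstaining_classifier" where
  "bayes_classifier \<delta> P = arg_min_on (risk P) (feasible_classifiers \<delta> (marginal P))"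

text \<open>
  A history of length \<open>t\<close> is a function on \<open>{..<t}\<close>, extended by \<^const>\<open>undefined\<close> as in
  \<^const>\<open>PiM\<close>. The internal randomness is a seed drawn before the first query from an arbitrary
  law on the reals; a real seed is enough to encode countably many further random draws.
\<close>

type_synonym 'x history = "nat \<Rightarrow> 'x \<times> bool"

abbreviation history_space :: "nat \<Rightarrow> (real ^ 'd) history measure" where
  "history_space t \<equiv> PiM {..<t} (\<lambda>_. labelled_space)"

record 'x learner =
  seed_law :: "real measure"
  query :: "nat \<Rightarrow> real \<Rightarrow> 'x history \<Rightarrow> 'x"
  learned :: "real \<Rightarrow> 'x history \<Rightarrow> 'x abstaining_classifier"

definition admissible_learner ::
    "real \<Rightarrow> nat \<Rightarrow> (real ^ 'd) measure \<Rightarrow> (real ^ 'd) learner \<Rightarrow> bool" where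
  "admissible_learner \<delta> n \<mu> A \<longleftrightarrow>
     prob_space (seed_law A) \<and> sets (seed_law A) = sets borel \<and>
     (\<forall>t<n. (\<lambda>(u, h). query A t u h) \<in> borel \<Otimes>\<^sub>M history_space t \<rightarrow>\<^sub>M cube_space) \<and>
     (\<forall>a. (\<lambda>((u, h), x). pmf (learned A u h x) a)
        \<in> borel_measurable ((borel \<Otimes>\<^sub>M history_space n) \<Otimes>\<^sub>M cube_space)) \<and>
     (\<forall>u. \<forall>h\<in>space (history_space n). learned A u h \<in> feasible_classifiers \<delta> \<mu>)"

text \<open>
  Feasibility of the output refers to $P_X$, so an algorithm may depend on $P_X$; it has access to
  \<open>\<eta>\<close> only through the queried labels. Algorithms that ignore $P_X$ are the constant functions here.
\<close>

definition active_algorithms ::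
    "real \<Rightarrow> nat \<Rightarrow> ((real ^ 'd) measure \<Rightarrow> (real ^ 'd) learner) set" where
  "active_algorithms \<delta> n =
     {\<A>. \<forall>\<mu>. prob_space \<mu> \<and> sets \<mu> = sets cube_space \<longrightarrow> admissible_learner \<delta> n \<mu> (\<A> \<mu>)}"

text \<open>The law of the first \<open>t\<close> queries and labels, given the value of the seed.\<close>

primrec transcript ::
    "('x \<Rightarrow> real) \<Rightarrow> (nat \<Rightarrow> 'x history \<Rightarrow> 'x) \<Rightarrow> nat \<Rightarrow> 'x history pmf" where
  "transcript \<eta> q 0 = return_pmf (\<lambda>_. undefined)"
| "transcript \<eta> q (Suc t) =
     bind_pmf (transcript \<eta> q t)
       (\<lambda>h. map_pmf (\<lambda>y. h(t := (q t h, y))) (bernoulli_pmf (\<eta> (q t h))))"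

definition expected_excess_risk ::
    "real \<Rightarrow> nat \<Rightarrow> ((real ^ 'd) \<times> bool) measure \<Rightarrow> (real ^ 'd \<Rightarrow> real) \<Rightarrow>
     (real ^ 'd) learner \<Rightarrow> real" where
  "expected_excess_risk \<delta> n P \<eta> A =
     (\<integral>u. measure_pmf.expectation (transcript \<eta> (\<lambda>t. query A t u) n)
            (\<lambda>h. risk P (learned A u h) - risk P (bayes_classifier \<delta> P)) \<partial>seed_law A)"

end

theory Submission
  imports Defs
begin

text \<open>
  The constant of the margin assumption may depend on the distribution, so it suffices to prove the
  larger bound $n^{-\beta/(2\beta+D)}$ with distributions that depend on $n$. A mass $\delta$ sits at a
  point where $\eta = 1/2$ and uses up the abstention budget; the centres of about $n^{D/(2\beta+D)}$
  disjoint bumps of height $\epsilon \sim n^{-\beta/(2\beta+D)}$ carry equal masses, and there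
  $\eta = 1/2 \pm \epsilon$ with unknown signs; the remaining mass lies on a segment where
  $\eta = 1/2 + \epsilon/2 + s$ with $P(s \le t) \sim t^{\alpha_0}$, which makes
  $\gamma_\delta = \epsilon/2$ and the margin assumption true. The regret at a centre is at least of
  order $\epsilon$ for one of the two signs, whether one decides or abstains.

  Each query informs about at most one sign. If a sign is flipped, the Hellinger affinity of the two laws
  of the transcript is at least $1 - 2\epsilon^2$ times the sum of the two expected numbers of queries
  in its cell, so on average over all signs a constant fraction of them cannot be learned (Assouad).
\<close>

subsection \<open>Assouad bound for adaptive queries\<close>

text \<open>The obstacle is that the law itself determines its thresholds. With only the atom at
  \<eta> = 1/2 and the centres, the supremum that defines the threshold would be \<epsilon>; the
  centres would be atoms exactly at 1/2 + \<epsilon> or 1/2 - \<epsilon>, and the margin assumption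
  would fail. Continuous mass that starts at distance \<epsilon>/2 stops the supremum there. The
  centres then keep distance \<epsilon>/2 from both thresholds, and since abstention is priced at
  1/2 - \<epsilon>/2, abstaining at a centre costs \<epsilon>/2 more than the right label.

  The scales come from a balance. A sign shows only after about \<epsilon>^-2 queries in its cell,
  so n queries cannot settle m cells while n \<epsilon>^2 is at most a small multiple of m. Hoelder
  continuity allows \<epsilon> ~ k^-\<beta> on a grid of m = k^D cells, which balances at k ~
  n^(1/(2\<beta>+D)).\<close>

primrec reachable :: "(nat \<Rightarrow> 'x history \<Rightarrow> 'x) \<Rightarrow> nat \<Rightarrow> 'x history set" where
  "reachable q 0 = {\<lambda>_. undefined}"
| "reachable q (Suc t) = (\<lambda>(h, y). h(t := (q t h, y))) ` (reachable q t \<times> UNIV)"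

definition path_weight :: "('x \<Rightarrow> bool \<Rightarrow> real) \<Rightarrow> nat \<Rightarrow> 'x history \<Rightarrow> real" where
  "path_weight a n h = (\<Prod>s<n. a (fst (h s)) (snd (h s)))"

definition label_weight :: "('x \<Rightarrow> real) \<Rightarrow> 'x \<Rightarrow> bool \<Rightarrow> real" where
  "label_weight \<eta> x y = (if y then \<eta> x else 1 - \<eta> x)"

text \<open>Once the seed is fixed, queries are functions of the past and only the labels branch.
  This is why every expectation over transcripts can be written as a finite sum.\<close>

lemma finite_reachable [simp]: "finite (reachable q n)"
  by (induction n) auto

lemma reachable_undefined: "h \<in> reachable q n \<Longrightarrow> n \<le> s \<Longrightarrow> h s = undefined"
  by (induction n arbitrary: h) auto

text \<open>A history of length t is \<open>undefined\<close> at position t, so overwriting that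
  position forgets nothing and the extension map is injective.\<close>

lemma sum_reachable_Suc:
  "(\<Sum>h\<in>reachable q (Suc t). f h) = (\<Sum>h\<in>reachable q t. \<Sum>y\<in>UNIV. f (h(t := (q t h, y))))"
proof -
  have "inj_on (\<lambda>(h, y). h(t := (q t h, y))) (reachable q t \<times> UNIV)"
  proof (rule inj_onI, clarify)
    fix h h' y y'
    assume h: "h \<in> reachable q t" "h' \<in> reachable q t"
      and eq: "h(t := (q t h, y)) = h'(t := (q t h', y'))"
    have "h s = h' s" for s
      using reachable_undefined[OF h(1), of t] reachable_undefined[OF h(2), of t] fun_cong[OF eq, of s]
      by (cases "s = t") auto
    moreover have "y = y'" using fun_cong[OF eq, of t] by simp
    ultimately show "h = h' \<and> y = y'" by auto
  qed
  then show ?thesis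
    by (simp add: sum.reindex sum.cartesian_product case_prod_unfold)
qed

lemma path_weight_0 [simp]: "path_weight a 0 h = 1"
  by (simp add: path_weight_def)

lemma path_weight_update [simp]:
  "path_weight a (Suc t) (h(t := (x, y))) = path_weight a t h * a x y"
  by (simp add: path_weight_def)

text \<open>Carries facts about the query rule over to the points recorded in a finished
  history.\<close>

lemma reachable_query:
  "h \<in> reachable q n \<Longrightarrow> s < n \<Longrightarrow> \<exists>h'\<in>reachable q s. fst (h s) = q s h'"
proof (induction n arbitrary: h)
  case (Suc n)
  then obtain h' y where h': "h' \<in> reachable q n" "h = h'(n := (q n h', y))" by auto
  show ?case
  proof (cases "s = n")
    case True
    then show ?thesis using h' by auto
  next
    case False
    then show ?thesis using h' Suc by auto
  qed
qed simp

lemma path_weight_nonneg: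
  assumes "\<And>t h. t < n \<Longrightarrow> h \<in> reachable q t \<Longrightarrow> 0 \<le> \<eta> (q t h) \<and> \<eta> (q t h) \<le> 1"
    and "h \<in> reachable q n"
  shows "0 \<le> path_weight (label_weight \<eta>) n h"
  unfolding path_weight_def
proof (intro prod_nonneg ballI)
  fix s assume "s \<in> {..<n}"
  then obtain h' where "h' \<in> reachable q s" "fst (h s) = q s h'" "s < n"
    using reachable_query assms(2) by blast
  with assms(1) show "0 \<le> label_weight \<eta> (fst (h s)) (snd (h s))"
    by (auto simp: label_weight_def)
qed

lemma sum_path_weight:
  "(\<Sum>h\<in>reachable q n. path_weight (label_weight \<eta>) n h) = 1"
proof (induction n)
  case (Suc n)
  then show ?case
    by (simp add: sum_reachable_Suc UNIV_bool label_weight_def algebra_simps del: reachable.simps)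
qed simp

lemma set_pmf_transcript: "set_pmf (transcript \<eta> q n) \<subseteq> reachable q n"
  by (induction n) auto

text \<open>\<open>bernoulli_pmf\<close> truncates its parameter to [0, 1], so it agrees with
  \<open>label_weight\<close> only where \<eta> has values in that interval; along the reachable
  queries this is assumed.\<close>

lemma expectation_transcript:
  fixes f :: "'x history \<Rightarrow> real"
  assumes "\<And>t h. t < n \<Longrightarrow> h \<in> reachable q t \<Longrightarrow> 0 \<le> \<eta> (q t h) \<and> \<eta> (q t h) \<le> 1"
  shows "measure_pmf.expectation (transcript \<eta> q n) f =
    (\<Sum>h\<in>reachable q n. path_weight (label_weight \<eta>) n h * f h)"
  using assms
proof (induction n arbitrary: f)
  case (Suc n)
  have "measure_pmf.expectation (transcript \<eta> q (Suc n)) f =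
      (\<Sum>h\<in>reachable q n. pmf (transcript \<eta> q n) h *
         measure_pmf.expectation (bernoulli_pmf (\<eta> (q n h))) (\<lambda>y. f (h(n := (q n h, y)))))"
    by (simp add: pmf_expectation_bind[OF finite_reachable _ set_pmf_transcript])
  also have "\<dots> = measure_pmf.expectation (transcript \<eta> q n)
      (\<lambda>h. measure_pmf.expectation (bernoulli_pmf (\<eta> (q n h))) (\<lambda>y. f (h(n := (q n h, y)))))"
    by (subst integral_measure_pmf_real[OF finite_reachable])
       (use set_pmf_transcript in \<open>auto simp: mult.commute\<close>)
  also have "\<dots> = (\<Sum>h\<in>reachable q n. path_weight (label_weight \<eta>) n h *
      measure_pmf.expectation (bernoulli_pmf (\<eta> (q n h))) (\<lambda>y. f (h(n := (q n h, y)))))"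
    by (rule Suc.IH) (use Suc.prems in auto)
  also have "\<dots> = (\<Sum>h\<in>reachable q n. path_weight (label_weight \<eta>) n h *
      (\<Sum>y\<in>UNIV. label_weight \<eta> (q n h) y * f (h(n := (q n h, y)))))"
  proof (intro sum.cong refl arg_cong2[where f = "(*)"])
    fix h assume "h \<in> reachable q n"
    then have "0 \<le> \<eta> (q n h)" "\<eta> (q n h) \<le> 1" using Suc.prems by auto
    then show "measure_pmf.expectation (bernoulli_pmf (\<eta> (q n h))) (\<lambda>y. f (h(n := (q n h, y)))) =
        (\<Sum>y\<in>UNIV. label_weight \<eta> (q n h) y * f (h(n := (q n h, y))))"
      by (simp add: UNIV_bool label_weight_def algebra_simps)
  qed
  also have "\<dots> = (\<Sum>h\<in>reachable q (Suc n). path_weight (label_weight \<eta>) (Suc n) h * f h)"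
    by (simp add: sum_reachable_Suc sum_distrib_left mult.assoc del: reachable.simps)
  finally show ?case .
qed simp

text \<open>Joins the combinatorial and the measure-theoretic view of histories: admissibility
  speaks about \<open>history_space\<close>, the sums run over \<open>reachable\<close>.\<close>

lemma reachable_subset_history_space:
  assumes "\<And>t h. t < n \<Longrightarrow> h \<in> space (history_space t) \<Longrightarrow> q t h \<in> unit_cube"
  shows "reachable q n \<subseteq> space (history_space n :: (real ^ 'd) history measure)"
  using assms
proof (induction n)
  case (Suc n)
  then have IH: "reachable q n \<subseteq> space (history_space n)" by simp
  show ?case
  proof
    fix h assume "h \<in> reachable q (Suc n)"
    then obtain h' y where h': "h' \<in> reachable q n" "h = h'(n := (q n h', y))" by auto
    have "h' \<in> space (history_space n)" using IH h' by auto
    moreover from this have "q n h' \<in> unit_cube" using Suc.prems by auto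
    ultimately show "h \<in> space (history_space (Suc n))"
      unfolding h' by (auto simp: space_PiM PiE_def Pi_def extensional_def space_pair_measure space_restrict_space less_Suc_eq)
  qed
qed (simp add: space_PiM)

section \<open>Affinity of two transcript laws that differ in one cell\<close>

lemma sqrt_product_label_weights:
  fixes b :: real
  assumes "\<bar>b\<bar> \<le> \<epsilon>" "\<epsilon> \<le> 1/2" "\<eta>\<^sub>0 x = 1/2 - b" "\<eta>\<^sub>1 x = 1/2 + b"
  shows "1 - 4 * \<epsilon>\<^sup>2 \<le> (\<Sum>y\<in>UNIV. sqrt (label_weight \<eta>\<^sub>0 x y * label_weight \<eta>\<^sub>1 x y))"
proof -
  have b: "b\<^sup>2 \<le> \<epsilon>\<^sup>2" using assms(1) by (metis abs_ge_zero power2_abs power_mono)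
  have "\<bar>b\<bar> \<le> 1/2" using assms by simp
  then have b': "b\<^sup>2 \<le> (1/2)\<^sup>2" by (metis abs_ge_zero power2_abs power_mono)
  \<comment> \<open>The affinity of the Bernoulli laws with parameters 1/2 - b and 1/2 + b is sqrt
    (1 - 4 b^2), and sqrt t \<ge> t for t in [0, 1].\<close>
  have "(1 - 4 * b\<^sup>2)\<^sup>2 \<le> 1 - 4 * b\<^sup>2"
    using b' by (simp add: power2_eq_square mult_left_le_one_le)
  then have "1 - 4 * b\<^sup>2 \<le> sqrt (1 - 4 * b\<^sup>2)" by (rule real_le_rsqrt)
  also have "sqrt (1 - 4 * b\<^sup>2) = 2 * sqrt (1/4 - b\<^sup>2)"
    using real_sqrt_mult[of 4 "1/4 - b\<^sup>2"] by simp
  finally have "1 - 4 * \<epsilon>\<^sup>2 \<le> 2 * sqrt (1/4 - b\<^sup>2)" using b by simp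
  moreover have "(1/2 - b) * (1/2 + b) = 1/4 - b\<^sup>2" "(1 - (1/2 - b)) * (1 - (1/2 + b)) = 1/4 - b\<^sup>2"
    by (simp_all add: power2_eq_square algebra_simps)
  ultimately show ?thesis
    by (simp add: UNIV_bool label_weight_def assms(3,4))
qed

text \<open>The affinity starts at 1, and a query in the distinguished cell multiplies the
  contribution of a path by at least 1 - 4 \<epsilon>^2. The arithmetic-geometric mean inequality
  makes this loss linear in the two path weights. It thus becomes an expected number of visits, a
  quantity that can later be summed over the cells.\<close>

lemma affinity_ge:
  fixes q :: "nat \<Rightarrow> 'x history \<Rightarrow> 'x"
  assumes q: "\<And>t h. t < n \<Longrightarrow> h \<in> reachable q t \<Longrightarrow> q t h \<in> X"
    and range: "\<And>x. x \<in> X \<Longrightarrow> 0 \<le> \<eta>\<^sub>0 x \<and> \<eta>\<^sub>0 x \<le> 1 \<and> 0 \<le> \<eta>\<^sub>1 x \<and> \<eta>\<^sub>1 x \<le> 1"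
    and out: "\<And>x. x \<in> X \<Longrightarrow> \<not> c x \<Longrightarrow> \<eta>\<^sub>0 x = \<eta>\<^sub>1 x"
    and inside: "\<And>x. x \<in> X \<Longrightarrow> c x \<Longrightarrow> \<exists>b. \<bar>b\<bar> \<le> \<epsilon> \<and> \<eta>\<^sub>0 x = 1/2 - b \<and> \<eta>\<^sub>1 x = 1/2 + b"
    and \<epsilon>: "0 \<le> \<epsilon>" "\<epsilon> \<le> 1/2"
  defines "W\<^sub>0 \<equiv> path_weight (label_weight \<eta>\<^sub>0)" and "W\<^sub>1 \<equiv> path_weight (label_weight \<eta>\<^sub>1)"
  shows "1 - 2 * \<epsilon>\<^sup>2 * (\<Sum>h\<in>reachable q n. (W\<^sub>0 n h + W\<^sub>1 n h) * (\<Sum>s<n. of_bool (c (fst (h s)))))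
    \<le> (\<Sum>h\<in>reachable q n. sqrt (W\<^sub>0 n h * W\<^sub>1 n h))"
  using q
proof (induction n)
  case (Suc n)
  define T where "T m h = (\<Sum>s<m. of_bool (c (fst (h s))) :: real)" for m and h :: "'x history"
  have T_upd: "T (Suc n) (h(n := (x, y))) = T n h + of_bool (c x)" for h x y
    by (simp add: T_def)
  have upd: "W\<^sub>0 (Suc n) (h(n := (x, y))) = W\<^sub>0 n h * label_weight \<eta>\<^sub>0 x y"
    "W\<^sub>1 (Suc n) (h(n := (x, y))) = W\<^sub>1 n h * label_weight \<eta>\<^sub>1 x y" for h x y
    by (simp_all add: W\<^sub>0_def W\<^sub>1_def)
  have IH: "1 - 2 * \<epsilon>\<^sup>2 * (\<Sum>h\<in>reachable q n. (W\<^sub>0 n h + W\<^sub>1 n h) * T n h)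
      \<le> (\<Sum>h\<in>reachable q n. sqrt (W\<^sub>0 n h * W\<^sub>1 n h))"
    unfolding T_def by (rule Suc.IH) (use Suc.prems in auto)
  have nn: "0 \<le> W\<^sub>0 n h" "0 \<le> W\<^sub>1 n h" if "h \<in> reachable q n" for h
    unfolding W\<^sub>0_def W\<^sub>1_def
    by (rule path_weight_nonneg[OF _ that]; use Suc.prems range in auto)+
  have step: "sqrt (W\<^sub>0 n h * W\<^sub>1 n h) - 2 * \<epsilon>\<^sup>2 * ((W\<^sub>0 n h + W\<^sub>1 n h) * of_bool (c (q n h)))
     \<le> (\<Sum>y\<in>UNIV. sqrt (W\<^sub>0 (Suc n) (h(n := (q n h, y))) * W\<^sub>1 (Suc n) (h(n := (q n h, y)))))"
    if h: "h \<in> reachable q n" for h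
  proof -
    let ?x = "q n h"
    let ?r = "\<Sum>y\<in>UNIV. sqrt (label_weight \<eta>\<^sub>0 ?x y * label_weight \<eta>\<^sub>1 ?x y)"
    have x: "?x \<in> X" using Suc.prems h by auto
    have \<rho>: "1 - 4 * \<epsilon>\<^sup>2 * of_bool (c ?x) \<le> ?r"
    proof (cases "c ?x")
      case True
      then show ?thesis using inside[OF x True] sqrt_product_label_weights[of _ \<epsilon> \<eta>\<^sub>0 ?x \<eta>\<^sub>1] \<epsilon> by auto
    next
      case False
      then show ?thesis using range[OF x] out[OF x False] by (simp add: UNIV_bool label_weight_def)
    qed
    let ?s = "sqrt (W\<^sub>0 n h * W\<^sub>1 n h)"
    have am: "2 * ?s \<le> W\<^sub>0 n h + W\<^sub>1 n h"
      using arith_geo_mean_sqrt[OF nn[OF h]] by simp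
    have "?s - 2 * \<epsilon>\<^sup>2 * ((W\<^sub>0 n h + W\<^sub>1 n h) * of_bool (c ?x)) \<le> ?s * (1 - 4 * \<epsilon>\<^sup>2 * of_bool (c ?x))"
      using mult_left_mono[OF am, of "2 * \<epsilon>\<^sup>2"] by (cases "c ?x") (auto simp: algebra_simps)
    also have "\<dots> \<le> ?s * ?r"
      using \<rho> nn[OF h] by (intro mult_left_mono) auto
    also have "\<dots> = (\<Sum>y\<in>UNIV. sqrt (W\<^sub>0 (Suc n) (h(n := (?x, y))) * W\<^sub>1 (Suc n) (h(n := (?x, y)))))"
      by (simp add: upd sum_distrib_left real_sqrt_mult algebra_simps)
    finally show ?thesis .
  qed
  \<comment> \<open>The two label weights sum to 1, so one more label leaves the total for the
    earlier visits unchanged and only the new query adds a term.\<close>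
  have T_sum: "(\<Sum>h\<in>reachable q (Suc n). (W\<^sub>0 (Suc n) h + W\<^sub>1 (Suc n) h) * T (Suc n) h) =
     (\<Sum>h\<in>reachable q n. (W\<^sub>0 n h + W\<^sub>1 n h) * T n h) +
     (\<Sum>h\<in>reachable q n. (W\<^sub>0 n h + W\<^sub>1 n h) * of_bool (c (q n h)))"
    unfolding sum_reachable_Suc upd T_upd sum.distrib[symmetric]
    by (intro sum.cong refl) (simp add: UNIV_bool label_weight_def algebra_simps)
  have "1 - 2 * \<epsilon>\<^sup>2 * (\<Sum>h\<in>reachable q (Suc n). (W\<^sub>0 (Suc n) h + W\<^sub>1 (Suc n) h) * T (Suc n) h)
     = 1 - 2 * \<epsilon>\<^sup>2 * (\<Sum>h\<in>reachable q n. (W\<^sub>0 n h + W\<^sub>1 n h) * T n h)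
     - 2 * \<epsilon>\<^sup>2 * (\<Sum>h\<in>reachable q n. (W\<^sub>0 n h + W\<^sub>1 n h) * of_bool (c (q n h)))"
    unfolding T_sum by (simp only: algebra_simps)
  also have "\<dots> \<le> (\<Sum>h\<in>reachable q n. sqrt (W\<^sub>0 n h * W\<^sub>1 n h)
      - 2 * \<epsilon>\<^sup>2 * ((W\<^sub>0 n h + W\<^sub>1 n h) * of_bool (c (q n h))))"
    using IH unfolding sum_subtractf sum_distrib_left[symmetric] by linarith
  also have "\<dots> \<le> (\<Sum>h\<in>reachable q (Suc n). sqrt (W\<^sub>0 (Suc n) h * W\<^sub>1 (Suc n) h))"
    unfolding sum_reachable_Suc by (intro sum_mono step)
  finally show ?case unfolding T_def .
qed (simp add: W\<^sub>0_def W\<^sub>1_def)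

text \<open>Expands (2 sqrt q - sqrt p)^2 \<ge> 0 and its mirror image. Unlike the bound on total
  variation by Cauchy-Schwarz, this one is linear in the affinity and can be averaged over sign
  patterns; for two probability laws of affinity 1 it gives 2/3.\<close>

lemma min_ge_affinity:
  fixes p q :: real
  assumes "0 \<le> p" "0 \<le> q"
  shows "4/3 * sqrt (p * q) - (p + q) / 3 \<le> min p q"
proof -
  have *: "4/3 * sqrt (p * q) - (p + q) / 3 \<le> q" if "0 \<le> p" "0 \<le> q" for p q :: real
  proof -
    have "0 \<le> (2 * sqrt q - sqrt p)\<^sup>2" by simp
    also have "\<dots> = 4 * q + p - 4 * sqrt (p * q)"
      using that by (simp add: power2_diff power_mult_distrib real_sqrt_mult)
    finally show ?thesis by (simp add: field_simps)
  qed
  show ?thesis using *[of p q] *[of q p] assms by (simp add: mult.commute add.commute)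
qed

text \<open>Pairs every sign pattern with its flip at \<open>i\<close>, the two laws to be
  compared.\<close>

lemma sum_Pow_insert_pairs:
  fixes f :: "'i set \<Rightarrow> real"
  assumes "finite I" "i \<in> I"
  shows "(\<Sum>S\<in>Pow I. f S) = (\<Sum>S\<in>Pow (I - {i}). f S + f (insert i S))"
proof -
  have "Pow I = Pow (I - {i}) \<union> insert i ` Pow (I - {i})"
    using Pow_insert[of i "I - {i}"] assms by (simp add: insert_absorb)
  moreover have "Pow (I - {i}) \<inter> insert i ` Pow (I - {i}) = {}" by auto
  moreover have "inj_on (insert i) (Pow (I - {i}))"
    by (rule inj_onI) (metis Diff_insert_absorb PowD insert_Diff_single subset_Diff_insert)
  ultimately show ?thesis
    using assms(1) by (simp add: sum.union_disjoint sum.reindex sum.distrib)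
qed

text \<open>An adaptive learner may study a chosen cell thoroughly, so no single sign is sure to
  stay hidden; the bound holds after summing over all signs, because the visits to all cells
  together number at most n. The set \<open>S\<close> collects the positive signs, and
  \<open>l i y h\<close> is the loss at cell \<open>i\<close> when its sign is
  \<open>y\<close>.\<close>

lemma assouad_transcript:
  fixes q :: "nat \<Rightarrow> 'x history \<Rightarrow> 'x" and \<eta> :: "'i set \<Rightarrow> 'x \<Rightarrow> real"
    and \<epsilon> \<kappa> :: real
  assumes I: "finite I"
    and q: "\<And>t h. t < n \<Longrightarrow> h \<in> reachable q t \<Longrightarrow> q t h \<in> X"
    and range: "\<And>S x. S \<subseteq> I \<Longrightarrow> x \<in> X \<Longrightarrow> 0 \<le> \<eta> S x \<and> \<eta> S x \<le> 1"
    and out: "\<And>S i x. S \<subseteq> I \<Longrightarrow> i \<in> I \<Longrightarrow> i \<notin> S \<Longrightarrow> x \<in> X \<Longrightarrow> \<not> c i x \<Longrightarrow> \<eta> S x = \<eta> (insert i S) x"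
    and inside: "\<And>S i x. S \<subseteq> I \<Longrightarrow> i \<in> I \<Longrightarrow> i \<notin> S \<Longrightarrow> x \<in> X \<Longrightarrow> c i x \<Longrightarrow>
      \<exists>b. \<bar>b\<bar> \<le> \<epsilon> \<and> \<eta> S x = 1/2 - b \<and> \<eta> (insert i S) x = 1/2 + b"
    and disj: "\<And>i j x. i \<in> I \<Longrightarrow> j \<in> I \<Longrightarrow> x \<in> X \<Longrightarrow> c i x \<Longrightarrow> c j x \<Longrightarrow> i = j"
    and \<epsilon>: "0 \<le> \<epsilon>" "\<epsilon> \<le> 1/2" "16 * \<epsilon>\<^sup>2 * n \<le> card I"
    and loss: "\<And>i y h. i \<in> I \<Longrightarrow> h \<in> reachable q n \<Longrightarrow> 0 \<le> l i y h"
      "\<And>i h. i \<in> I \<Longrightarrow> h \<in> reachable q n \<Longrightarrow> \<kappa> \<le> l i True h + l i False h"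
    and \<kappa>: "0 \<le> \<kappa>"
  shows "\<kappa> * 2 ^ card I * card I / 6 \<le>
    (\<Sum>S\<in>Pow I. measure_pmf.expectation (transcript (\<eta> S) q n) (\<lambda>h. \<Sum>i\<in>I. l i (i \<in> S) h))"
proof -
  define W where "W S = path_weight (label_weight (\<eta> S)) n" for S
  define T where "T i h = (\<Sum>s<n. of_bool (c i (fst (h s))) :: real)" for i and h :: "'x history"
  let ?R = "reachable q n"
  have nn: "0 \<le> W S h" if "S \<subseteq> I" "h \<in> ?R" for S h
    unfolding W_def by (rule path_weight_nonneg[OF _ that(2)]) (use range q that in auto)
  have exp: "measure_pmf.expectation (transcript (\<eta> S) q n) f = (\<Sum>h\<in>?R. W S h * f h)"
    if "S \<subseteq> I" for S f
    unfolding W_def by (rule expectation_transcript) (use range q that in auto)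
  have pair: "\<kappa> * (2/3) - \<kappa> * (8/3) * \<epsilon>\<^sup>2 * ((\<Sum>h\<in>?R. W S h * T i h) + (\<Sum>h\<in>?R. W (insert i S) h * T i h))
      \<le> (\<Sum>h\<in>?R. W S h * l i (i \<in> S) h) + (\<Sum>h\<in>?R. W (insert i S) h * l i (i \<in> insert i S) h)"
    if i: "i \<in> I" and S: "S \<subseteq> I - {i}" for i S
  proof -
    let ?S = "insert i S"
    have SI: "S \<subseteq> I" "?S \<subseteq> I" "i \<notin> S" using i S by auto
    have aff: "1 - 2 * \<epsilon>\<^sup>2 * (\<Sum>h\<in>?R. (W S h + W ?S h) * T i h) \<le> (\<Sum>h\<in>?R. sqrt (W S h * W ?S h))"
      unfolding W_def T_def
      by (rule affinity_ge[where X = X]) (use q range SI out inside \<epsilon> i in auto)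
    have "2/3 - (8/3) * \<epsilon>\<^sup>2 * (\<Sum>h\<in>?R. (W S h + W ?S h) * T i h)
        \<le> 4/3 * (\<Sum>h\<in>?R. sqrt (W S h * W ?S h)) - (\<Sum>h\<in>?R. W S h + W ?S h) / 3"
      using aff by (simp add: sum.distrib W_def sum_path_weight algebra_simps)
    also have "\<dots> = (\<Sum>h\<in>?R. 4/3 * sqrt (W S h * W ?S h) - (W S h + W ?S h) / 3)"
      by (simp add: sum_subtractf sum_distrib_left sum_divide_distrib)
    also have "\<dots> \<le> (\<Sum>h\<in>?R. min (W S h) (W ?S h))"
      by (intro sum_mono min_ge_affinity nn SI)
    finally have m: "2/3 - (8/3) * \<epsilon>\<^sup>2 * (\<Sum>h\<in>?R. (W S h + W ?S h) * T i h)
        \<le> (\<Sum>h\<in>?R. min (W S h) (W ?S h))" .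
    \<comment> \<open>On the common mass of the two laws the learner sees the same history and
      reacts in the same way, so it pays the losses for both signs, at least \<kappa> in
      total.\<close>
    have "\<kappa> * (\<Sum>h\<in>?R. min (W S h) (W ?S h)) \<le> (\<Sum>h\<in>?R. W S h * l i False h + W ?S h * l i True h)"
      unfolding sum_distrib_left
    proof (rule sum_mono)
      fix h assume h: "h \<in> ?R"
      let ?m = "min (W S h) (W ?S h)"
      have "0 \<le> ?m" using nn[OF SI(1) h] nn[OF SI(2) h] by simp
      then have "\<kappa> * ?m \<le> (l i True h + l i False h) * ?m"
        using loss(2)[OF i h] by (intro mult_right_mono) auto
      also have "\<dots> = ?m * l i False h + ?m * l i True h" by (simp add: algebra_simps)
      also have "\<dots> \<le> W S h * l i False h + W ?S h * l i True h"
        using loss(1)[OF i h] by (intro add_mono mult_right_mono) auto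
      finally show "\<kappa> * ?m \<le> W S h * l i False h + W ?S h * l i True h" .
    qed
    with mult_left_mono[OF m \<kappa>] SI(3) show ?thesis
      by (simp add: sum.distrib algebra_simps)
  qed
  \<comment> \<open>Disjoint cells turn the n queries into a budget shared by all signs, however
    adaptively they are spent.\<close>
  have T_le: "(\<Sum>i\<in>I. T i h) \<le> n" if h: "h \<in> ?R" for h
  proof -
    have "(\<Sum>i\<in>I. T i h) = (\<Sum>s<n. \<Sum>i\<in>I. of_bool (c i (fst (h s))))"
      unfolding T_def by (rule sum.swap)
    also have "\<dots> \<le> (\<Sum>s<n. 1)"
    proof (rule sum_mono)
      fix s assume "s \<in> {..<n}"
      then have X: "fst (h s) \<in> X" using reachable_query[OF h, of s] q by auto
      have "(\<Sum>i\<in>I. of_bool (c i (fst (h s)))) = real (card {i\<in>I. c i (fst (h s))})"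
        using I by (simp add: of_bool_def Collect_conj_eq sum.If_cases)
      also have "card {i\<in>I. c i (fst (h s))} \<le> 1"
        using I disj[OF _ _ X] by (auto simp: card_le_Suc0_iff_eq)
      finally show "(\<Sum>i\<in>I. of_bool (c i (fst (h s)))) \<le> (1::real)" by simp
    qed
    finally show ?thesis by simp
  qed
  have TS: "(\<Sum>S\<in>Pow I. \<Sum>i\<in>I. \<Sum>h\<in>?R. W S h * T i h) \<le> 2 ^ card I * n"
  proof -
    have "(\<Sum>i\<in>I. \<Sum>h\<in>?R. W S h * T i h) \<le> n" if "S \<in> Pow I" for S
    proof -
      have "(\<Sum>i\<in>I. \<Sum>h\<in>?R. W S h * T i h) = (\<Sum>h\<in>?R. W S h * (\<Sum>i\<in>I. T i h))"
        unfolding sum_distrib_left by (rule sum.swap)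
      also have "\<dots> \<le> (\<Sum>h\<in>?R. W S h * n)"
        using that by (intro sum_mono mult_left_mono T_le nn) auto
      also have "\<dots> = n"
        unfolding sum_distrib_right[symmetric] W_def sum_path_weight by simp
      finally show ?thesis .
    qed
    then have "(\<Sum>S\<in>Pow I. \<Sum>i\<in>I. \<Sum>h\<in>?R. W S h * T i h) \<le> (\<Sum>S\<in>Pow I. real n)"
      by (rule sum_mono)
    then show ?thesis by (simp add: card_Pow[OF I])
  qed
  have each: "\<kappa> * 2 ^ card I / 3 - \<kappa> * (8/3) * \<epsilon>\<^sup>2 * (\<Sum>S\<in>Pow I. \<Sum>h\<in>?R. W S h * T i h)
      \<le> (\<Sum>S\<in>Pow I. \<Sum>h\<in>?R. W S h * l i (i \<in> S) h)" if i: "i \<in> I" for i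
  proof -
    have "card I = Suc (card (I - {i}))" using I i by (metis card_Suc_Diff1)
    then have card: "2 ^ card I = 2 * (2::real) ^ card (I - {i})" by simp
    have "(\<Sum>S\<in>Pow (I - {i}). \<kappa> * (2/3) - \<kappa> * (8/3) * \<epsilon>\<^sup>2 *
          ((\<Sum>h\<in>?R. W S h * T i h) + (\<Sum>h\<in>?R. W (insert i S) h * T i h)))
       \<le> (\<Sum>S\<in>Pow I. \<Sum>h\<in>?R. W S h * l i (i \<in> S) h)"
      unfolding sum_Pow_insert_pairs[OF I i] by (intro sum_mono pair i) auto
    then show ?thesis
      unfolding sum_Pow_insert_pairs[OF I i] sum_subtractf sum_distrib_left[symmetric]
      using I by (simp add: card card_Pow)
  qed
  \<comment> \<open>Each sign contributes 2/3 for each of the 2^(card I - 1) pairs, that is 1/3 for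
    each pattern. The visits take away at most 8/3 * \<epsilon>^2 * n for each pattern, which is at
    most card I / 6 by the bound on 16 * \<epsilon>^2 * n; and 1/3 - 1/6 = 1/6.\<close>
  have "\<kappa> * 2 ^ card I * card I / 6 \<le>
      card I * (\<kappa> * 2 ^ card I / 3) - \<kappa> * (8/3) * \<epsilon>\<^sup>2 * (2 ^ card I * n)"
    using mult_left_mono[OF \<epsilon>(3), of "\<kappa> * 2 ^ card I / 6"] \<kappa> by (simp add: algebra_simps)
  also have "\<dots> \<le> card I * (\<kappa> * 2 ^ card I / 3) -
      \<kappa> * (8/3) * \<epsilon>\<^sup>2 * (\<Sum>S\<in>Pow I. \<Sum>i\<in>I. \<Sum>h\<in>?R. W S h * T i h)"
    using mult_left_mono[OF TS, of "\<kappa> * (8/3) * \<epsilon>\<^sup>2"] \<kappa> by simp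
  also have "\<dots> = (\<Sum>i\<in>I. \<kappa> * 2 ^ card I / 3 - \<kappa> * (8/3) * \<epsilon>\<^sup>2 * (\<Sum>S\<in>Pow I. \<Sum>h\<in>?R. W S h * T i h))"
    unfolding sum_subtractf sum_distrib_left[symmetric] sum.swap[of _ I] by simp
  also have "\<dots> \<le> (\<Sum>i\<in>I. \<Sum>S\<in>Pow I. \<Sum>h\<in>?R. W S h * l i (i \<in> S) h)"
    by (intro sum_mono each)
  also have "\<dots> = (\<Sum>S\<in>Pow I. \<Sum>i\<in>I. \<Sum>h\<in>?R. W S h * l i (i \<in> S) h)"
    by (rule sum.swap)
  also have "\<dots> = (\<Sum>S\<in>Pow I. measure_pmf.expectation (transcript (\<eta> S) q n) (\<lambda>h. \<Sum>i\<in>I. l i (i \<in> S) h))"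
    by (intro sum.cong refl, subst exp) (auto simp: sum_distrib_left intro: sum.swap)
  finally show ?thesis .
qed

subsection \<open>Joint laws with a given regression function\<close>

lemma space_cube [simp]: "space cube_space = unit_cube"
  by (simp add: space_restrict_space)

locale cube_model = prob_space \<mu> for \<mu> :: "(real ^ 'd) measure" +
  fixes \<eta> :: "real ^ 'd \<Rightarrow> real"
  assumes sets_\<mu> [measurable_cong]: "sets \<mu> = sets cube_space"
    and \<eta>_measurable [measurable]: "\<eta> \<in> borel_measurable cube_space"
    and \<eta>_range: "x \<in> unit_cube \<Longrightarrow> 0 \<le> \<eta> x \<and> \<eta> x \<le> 1"
begin

definition joint_law :: "((real ^ 'd) \<times> bool) measure" where
  "joint_law = density (\<mu> \<Otimes>\<^sub>M count_space UNIV) (\<lambda>z. ennreal (label_weight \<eta> (fst z) (snd z)))"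

lemma space_\<mu>: "space \<mu> = unit_cube"
  using sets_eq_imp_space_eq[OF sets_\<mu>] by simp

lemma sets_joint_law [measurable_cong]: "sets joint_law = sets labelled_space"
  unfolding joint_law_def sets_density by (rule sets_pair_measure_cong) (auto simp: sets_\<mu>)

lemma space_joint_law: "space joint_law = unit_cube \<times> UNIV"
  using sets_eq_imp_space_eq[OF sets_joint_law] by (simp add: space_pair_measure)

lemma label_weight_measurable [measurable]:
  "(\<lambda>z. label_weight \<eta> (fst z) (snd z)) \<in> borel_measurable (\<mu> \<Otimes>\<^sub>M count_space UNIV)"
  unfolding label_weight_def by measurable

lemma label_weight_nonneg: "x \<in> unit_cube \<Longrightarrow> 0 \<le> label_weight \<eta> x y"
  using \<eta>_range by (auto simp: label_weight_def)

lemma nn_integral_joint_law: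
  assumes [measurable]: "f \<in> borel_measurable labelled_space"
  shows "(\<integral>\<^sup>+z. f z \<partial>joint_law) =
    (\<integral>\<^sup>+x. ennreal (\<eta> x) * f (x, True) + ennreal (1 - \<eta> x) * f (x, False) \<partial>\<mu>)"
proof -
  interpret C: sigma_finite_measure "count_space (UNIV :: bool set)"
    by (rule sigma_finite_measure_count_space_finite) simp
  have [measurable]: "f \<in> borel_measurable (\<mu> \<Otimes>\<^sub>M count_space UNIV)"
    using assms by (simp cong: measurable_cong_sets sets_pair_measure_cong add: sets_\<mu>)
  have "(\<integral>\<^sup>+z. f z \<partial>joint_law) =
      (\<integral>\<^sup>+z. ennreal (label_weight \<eta> (fst z) (snd z)) * f z \<partial>(\<mu> \<Otimes>\<^sub>M count_space UNIV))"
    unfolding joint_law_def by (rule nn_integral_density) measurable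
  also have "\<dots> = (\<integral>\<^sup>+x. \<integral>\<^sup>+y. ennreal (label_weight \<eta> x y) * f (x, y) \<partial>count_space UNIV \<partial>\<mu>)"
    by (subst C.nn_integral_fst[symmetric]) simp_all
  finally show ?thesis
    by (simp add: nn_integral_count_space_finite UNIV_bool label_weight_def add.commute)
qed

lemma integral_joint_law:
  fixes f :: "(real ^ 'd) \<times> bool \<Rightarrow> real"
  assumes [measurable]: "f \<in> borel_measurable labelled_space"
    and bound: "\<And>x y. x \<in> unit_cube \<Longrightarrow> \<bar>f (x, y)\<bar> \<le> B"
  shows "(\<integral>z. f z \<partial>joint_law) = (\<integral>x. \<eta> x * f (x, True) + (1 - \<eta> x) * f (x, False) \<partial>\<mu>)"
proof -
  interpret C: finite_measure "count_space (UNIV :: bool set)"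
    by (rule finite_measure_count_space) simp
  interpret pair_sigma_finite \<mu> "count_space (UNIV :: bool set)" ..
  let ?M = "\<mu> \<Otimes>\<^sub>M count_space (UNIV :: bool set)"
  interpret M: finite_measure ?M
    by (rule finite_measure_pair_measure) unfold_locales
  have [measurable]: "f \<in> borel_measurable ?M"
    using assms by (simp cong: measurable_cong_sets sets_pair_measure_cong add: sets_\<mu>)
  have sp: "space ?M = unit_cube \<times> UNIV" by (simp add: space_pair_measure space_\<mu>)
  have "(\<integral>z. f z \<partial>joint_law) = (\<integral>z. label_weight \<eta> (fst z) (snd z) *\<^sub>R f z \<partial>?M)"
    unfolding joint_law_def
    by (rule integral_density) (auto intro!: AE_I2 simp: sp label_weight_nonneg)
  also have "\<dots> = (\<integral>x. \<integral>y. label_weight \<eta> x y * f (x, y) \<partial>count_space UNIV \<partial>\<mu>)"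
  proof (subst integral_fst'[symmetric])
    show "integrable ?M (\<lambda>z. label_weight \<eta> (fst z) (snd z) *\<^sub>R f z)"
    proof (rule M.integrable_const_bound[where B = B])
      show "AE z in ?M. norm (label_weight \<eta> (fst z) (snd z) *\<^sub>R f z) \<le> B"
      proof (rule AE_I2)
        fix z assume "z \<in> space ?M"
        then have z: "fst z \<in> unit_cube" by (auto simp: sp)
        have "\<bar>label_weight \<eta> (fst z) (snd z)\<bar> \<le> 1"
          using \<eta>_range[OF z] by (auto simp: label_weight_def)
        then show "norm (label_weight \<eta> (fst z) (snd z) *\<^sub>R f z) \<le> B"
          using mult_mono[of "\<bar>label_weight \<eta> (fst z) (snd z)\<bar>" 1 "\<bar>f z\<bar>" B] bound[OF z, of "snd z"]
          by (simp add: abs_mult)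
      qed
    qed measurable
  qed simp_all
  finally show ?thesis
    by (simp add: lebesgue_integral_count_space_finite UNIV_bool label_weight_def add.commute
        cong: Bochner_Integration.integral_cong)
qed

lemma prob_space_joint_law: "prob_space joint_law"
proof
  have "emeasure joint_law (space joint_law) = (\<integral>\<^sup>+z. 1 \<partial>joint_law)" by simp
  also have "\<dots> = (\<integral>\<^sup>+x. ennreal (\<eta> x) + ennreal (1 - \<eta> x) \<partial>\<mu>)"
    by (subst nn_integral_joint_law) simp_all
  also have "\<dots> = (\<integral>\<^sup>+x. 1 \<partial>\<mu>)"
    using \<eta>_range by (intro nn_integral_cong) (simp add: space_\<mu> flip: ennreal_plus)
  finally show "emeasure joint_law (space joint_law) = 1" by (simp add: emeasure_space_1)
qed

lemma joint_distribution_joint_law: "joint_distribution joint_law"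
  by (simp add: joint_distribution_def prob_space_joint_law sets_joint_law)

lemma marginal_joint_law: "marginal joint_law = \<mu>"
proof (rule measure_eqI)
  show "sets (marginal joint_law) = sets \<mu>" by (simp add: marginal_def sets_\<mu>)
  fix A assume "A \<in> sets (marginal joint_law)"
  then have A [measurable]: "A \<in> sets cube_space" by (simp add: marginal_def)
  have [measurable]: "fst \<in> joint_law \<rightarrow>\<^sub>M cube_space" by measurable
  have "emeasure (marginal joint_law) A = (\<integral>\<^sup>+z. indicator A (fst z) \<partial>joint_law)"
  proof -
    have "emeasure (marginal joint_law) A = (\<integral>\<^sup>+x. indicator A x \<partial>marginal joint_law)"
      by (simp add: marginal_def)
    also have "\<dots> = (\<integral>\<^sup>+z. indicator A (fst z) \<partial>joint_law)"
      unfolding marginal_def by (rule nn_integral_distr) measurable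
    finally show ?thesis .
  qed
  also have "\<dots> = (\<integral>\<^sup>+x. ennreal (\<eta> x) * indicator A x + ennreal (1 - \<eta> x) * indicator A x \<partial>\<mu>)"
    by (subst nn_integral_joint_law) simp_all
  also have "\<dots> = (\<integral>\<^sup>+x. indicator A x \<partial>\<mu>)"
    using \<eta>_range
    by (intro nn_integral_cong) (simp add: space_\<mu> flip: distrib_right ennreal_plus)
  finally show "emeasure (marginal joint_law) A = emeasure \<mu> A"
    using A by (simp add: sets_\<mu>)
qed

text \<open>A set of the sigma-algebra generated by X is the preimage of some B. Over it, the label
  and \<eta>(X) both integrate to the \<mu>-integral of \<eta> over B, which characterizes the
  conditional expectation.\<close>

lemma regression_function_joint_law: "regression_function joint_law \<eta>"
  unfolding regression_function_def
proof (intro conjI ballI)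
  interpret P: prob_space joint_law by (rule prob_space_joint_law)
  let ?F = "vimage_algebra (space joint_law) fst cube_space"
  have fst_space: "fst \<in> space joint_law \<rightarrow> space cube_space" by (auto simp: space_joint_law)
  have fst_F [measurable]: "fst \<in> ?F \<rightarrow>\<^sub>M cube_space"
    using fst_space by (rule measurable_vimage_algebra1)
  have "subalgebra joint_law ?F"
    unfolding subalgebra_def
  proof
    show "sets ?F \<subseteq> sets joint_law"
      by (rule sets_image_in_sets) (simp, measurable)
  qed simp
  then interpret finite_measure_subalgebra joint_law ?F
    by unfold_locales (auto simp: subalgebra_def)
  have m1 [measurable]: "(\<lambda>z. \<eta> (fst z)) \<in> borel_measurable labelled_space"
    and m2 [measurable]: "(\<lambda>(x :: real ^ 'd, y :: bool). of_bool y :: real) \<in> borel_measurable labelled_space"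
    by measurable
  have "AE z in joint_law. real_cond_exp joint_law ?F (\<lambda>(x, y). of_bool y) z = \<eta> (fst z)"
  proof (rule real_cond_exp_charact)
    fix A assume "A \<in> sets ?F"
    then obtain B where B [measurable]: "B \<in> sets cube_space" and A: "A = fst -` B \<inter> space joint_law"
      by (auto simp: sets_vimage_algebra2[OF fst_space])
    have ind: "indicator A z = (indicator B (fst z) :: real)" if "z \<in> space joint_law" for z
      using that by (auto simp: A indicator_def)
    have "(LINT z:A|joint_law. case z of (x, y) \<Rightarrow> (of_bool y :: real)) =
        (LINT z|joint_law. indicator B (fst z) * (case z of (x, y) \<Rightarrow> (of_bool y :: real)))"
      unfolding set_lebesgue_integral_def
      by (intro Bochner_Integration.integral_cong) (auto simp: ind)
    also have "\<dots> = (LINT x|\<mu>. \<eta> x * indicator B x)"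
      by (subst integral_joint_law[where B = 1]) (auto simp: indicator_def)
    also have "\<dots> = (LINT z|joint_law. indicator B (fst z) * \<eta> (fst z))"
      by (subst integral_joint_law[where B = 1])
         (use \<eta>_range in \<open>auto simp: indicator_def algebra_simps intro!: Bochner_Integration.integral_cong\<close>)
    also have "\<dots> = (LINT z:A|joint_law. \<eta> (fst z))"
      unfolding set_lebesgue_integral_def
      by (intro Bochner_Integration.integral_cong) (auto simp: ind)
    finally show "(LINT z:A|joint_law. case z of (x, y) \<Rightarrow> (of_bool y :: real)) = (LINT z:A|joint_law. \<eta> (fst z))" .
  next
    show "integrable joint_law (\<lambda>(x, y). of_bool y :: real)"
      by (rule P.integrable_const_bound[where B = 1]) (auto intro!: AE_I2)
    show "integrable joint_law (\<lambda>z. \<eta> (fst z))"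
      by (rule P.integrable_const_bound[where B = 1]) (use \<eta>_range in \<open>auto intro!: AE_I2 simp: space_joint_law\<close>)
    show "(\<lambda>z. \<eta> (fst z)) \<in> borel_measurable ?F" by measurable
  qed
  then show "AE z in joint_law. \<eta> (fst z) = real_cond_exp joint_law ?F (\<lambda>(x, y). of_bool y) z"
    by eventually_elim simp
qed (use \<eta>_range in auto)

lemma risk_joint_law:
  assumes "measurable_classifier g"
  shows "risk joint_law g =
    (\<integral>x. \<eta> x * pmf (g x) (Some False) + (1 - \<eta> x) * pmf (g x) (Some True) \<partial>\<mu>)"
proof -
  have g [measurable]: "\<And>a. (\<lambda>x. pmf (g x) a) \<in> borel_measurable cube_space"
    using assms by (simp add: measurable_classifier_def)
  have "{a. a \<noteq> Some y \<and> a \<noteq> None} = {Some (\<not> y)}" for y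
  proof -
    have "a \<noteq> Some y \<and> a \<noteq> None \<longleftrightarrow> a = Some (\<not> y)" for a by (cases a) auto
    then show ?thesis by auto
  qed
  then have "risk joint_law g = (\<integral>z. pmf (g (fst z)) (Some (\<not> snd z)) \<partial>joint_law)"
    by (simp add: risk_def case_prod_unfold measure_pmf_single)
  also have "\<dots> = (\<integral>z. (if snd z then pmf (g (fst z)) (Some False) else pmf (g (fst z)) (Some True)) \<partial>joint_law)"
    by (intro Bochner_Integration.integral_cong) auto
  also have "\<dots> = (\<integral>x. \<eta> x * pmf (g x) (Some False) + (1 - \<eta> x) * pmf (g x) (Some True) \<partial>\<mu>)"
    by (subst integral_joint_law[where B = 1]) (auto simp: pmf_le_1)
  finally show ?thesis .
qed

end

subsection \<open>Excess risk\<close>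

lemma expectation_transcript_Suc:
  fixes f :: "'x history \<Rightarrow> real"
  assumes "\<And>t h. t < Suc n \<Longrightarrow> h \<in> reachable q t \<Longrightarrow> 0 \<le> \<eta> (q t h) \<and> \<eta> (q t h) \<le> 1"
  shows "measure_pmf.expectation (transcript \<eta> q (Suc n)) f =
    measure_pmf.expectation (transcript \<eta> q n)
      (\<lambda>h. \<eta> (q n h) * f (h(n := (q n h, True))) + (1 - \<eta> (q n h)) * f (h(n := (q n h, False))))"
  using assms
  by (subst (1 2) expectation_transcript)
     (auto simp: sum_reachable_Suc UNIV_bool label_weight_def algebra_simps simp del: reachable.simps
       intro!: sum.cong)

lemma measurable_pmf_threshold [measurable]:
  assumes [measurable]: "Measurable.pred M P" "Measurable.pred M Q"
  shows "(\<lambda>x. pmf (if P x then return_pmf None else return_pmf (Some (Q x))) a) \<in> borel_measurable M"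
proof -
  have eq: "pmf (if P x then return_pmf None else return_pmf (Some (Q x))) a =
      (case a of None \<Rightarrow> if P x then 1 else 0 | Some b \<Rightarrow> if \<not> P x \<and> Q x = b then 1 else 0)" for x
    by (auto split: option.split simp: indicator_def)
  show ?thesis unfolding eq by (cases a) simp_all
qed

context cube_model
begin

text \<open>Each seed has its own transcript law with its own finite support, so measurability in
  the seed is not automatic. Averaging over the last label replaces the integrand by a jointly
  measurable function of a history that is shorter by one, until only the seed is left.\<close>

lemma measurable_expectation_transcript:
  fixes f :: "real \<times> (real ^ 'd) history \<Rightarrow> real"
  assumes q: "\<And>t. t < n \<Longrightarrow> (\<lambda>(u, h). q u t h) \<in> borel \<Otimes>\<^sub>M history_space t \<rightarrow>\<^sub>M cube_space"
    and f: "f \<in> borel_measurable (borel \<Otimes>\<^sub>M history_space n)"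
  shows "(\<lambda>u. measure_pmf.expectation (transcript \<eta> (q u) n) (\<lambda>h. f (u, h))) \<in> borel_measurable borel"
  using assms
proof (induction n arbitrary: f)
  case 0
  have "(\<lambda>u::real. (u, \<lambda>_. undefined)) \<in> borel \<rightarrow>\<^sub>M borel \<Otimes>\<^sub>M history_space 0"
    by (intro measurable_Pair measurable_const) (auto simp: space_PiM)
  from measurable_compose[OF this] 0
  have "(\<lambda>u. f (u, \<lambda>_. undefined)) \<in> borel_measurable borel" by simp
  moreover have "measure_pmf.expectation (transcript \<eta> (q u) 0) (\<lambda>h. f (u, h)) = f (u, \<lambda>_. undefined)" for u
    by (subst expectation_transcript) simp_all
  ultimately show ?case by (simp only:)
next
  case (Suc n)
  have q_cube: "q u t h \<in> unit_cube" if "t < Suc n" "h \<in> space (history_space t)" for u t h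
    using measurable_space[OF Suc.prems(1)[OF that(1)], of "(u, h)"] that
    by (simp add: space_pair_measure)
  have range: "0 \<le> \<eta> (q u t h) \<and> \<eta> (q u t h) \<le> 1" if "t < Suc n" "h \<in> reachable (q u) t" for u t h
    using reachable_subset_history_space[of t "q u"] q_cube that by (auto intro!: \<eta>_range)
  have [measurable]: "(\<lambda>z. q (fst z) n (snd z)) \<in> borel \<Otimes>\<^sub>M history_space n \<rightarrow>\<^sub>M cube_space"
    using Suc.prems(1)[of n] by (simp add: case_prod_unfold)
  note [measurable] = Suc.prems(2)
  have [measurable]: "(\<lambda>z. (snd z)(n := (q (fst z) n (snd z), y))) \<in>
      borel \<Otimes>\<^sub>M history_space n \<rightarrow>\<^sub>M history_space (Suc n)" for y
    unfolding lessThan_Suc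
    by (rule measurable_fun_upd[where J = "{..<n}"]) auto
  define f' where "f' z = \<eta> (q (fst z) n (snd z)) * f (fst z, (snd z)(n := (q (fst z) n (snd z), True)))
      + (1 - \<eta> (q (fst z) n (snd z))) * f (fst z, (snd z)(n := (q (fst z) n (snd z), False)))" for z
  have "f' \<in> borel_measurable (borel \<Otimes>\<^sub>M history_space n)"
    unfolding f'_def by measurable
  from Suc.IH[OF Suc.prems(1) this]
  have "(\<lambda>u. measure_pmf.expectation (transcript \<eta> (q u) n) (\<lambda>h. f' (u, h))) \<in> borel_measurable borel"
    by simp
  moreover have "measure_pmf.expectation (transcript \<eta> (q u) (Suc n)) (\<lambda>h. f (u, h)) =
      measure_pmf.expectation (transcript \<eta> (q u) n) (\<lambda>h. f' (u, h))" for u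
    unfolding f'_def using range by (subst expectation_transcript_Suc) auto
  ultimately show ?case by (simp only:)
qed

lemma risk_bounds:
  assumes "measurable_classifier g"
  shows "0 \<le> risk joint_law g" "risk joint_law g \<le> 1"
proof -
  have [measurable]: "\<And>a. (\<lambda>x. pmf (g x) a) \<in> borel_measurable cube_space"
    using assms by (simp add: measurable_classifier_def)
  have b: "0 \<le> \<eta> x * pmf (g x) (Some False) + (1 - \<eta> x) * pmf (g x) (Some True)"
    "\<eta> x * pmf (g x) (Some False) + (1 - \<eta> x) * pmf (g x) (Some True) \<le> 1"
    if "x \<in> unit_cube" for x
  proof -
    show "0 \<le> \<eta> x * pmf (g x) (Some False) + (1 - \<eta> x) * pmf (g x) (Some True)"
      using \<eta>_range[OF that] by simp
    have "\<eta> x * pmf (g x) (Some False) \<le> \<eta> x * 1" "(1 - \<eta> x) * pmf (g x) (Some True) \<le> (1 - \<eta> x) * 1"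
      using \<eta>_range[OF that] by (intro mult_left_mono pmf_le_1; simp)+
    then show "\<eta> x * pmf (g x) (Some False) + (1 - \<eta> x) * pmf (g x) (Some True) \<le> 1" by simp
  qed
  show "0 \<le> risk joint_law g"
    unfolding risk_joint_law[OF assms] by (intro integral_nonneg_AE AE_I2) (use b in \<open>simp add: space_\<mu>\<close>)
  show "risk joint_law g \<le> 1"
    unfolding risk_joint_law[OF assms]
    by (intro integral_le_const integrable_const_bound[where B = 1] AE_I2)
       (use b in \<open>simp_all add: space_\<mu>\<close>)
qed

section \<open>The Lagrangian of the constraint on the abstention rate\<close>

definition lagrangian_loss :: "real \<Rightarrow> (real ^ 'd) abstaining_classifier \<Rightarrow> real ^ 'd \<Rightarrow> real" where
  "lagrangian_loss \<gamma> g x = \<eta> x * pmf (g x) (Some False) + (1 - \<eta> x) * pmf (g x) (Some True)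
     + (1/2 - \<gamma>) * pmf (g x) None"

text \<open>This is Chow's optimal conditional risk when rejection has the fixed price 1/2 -
  \<gamma>.\<close>

definition bayes_loss :: "real \<Rightarrow> real ^ 'd \<Rightarrow> real" where
  "bayes_loss \<gamma> x = min (min (\<eta> x) (1 - \<eta> x)) (1/2 - \<gamma>)"

lemma pmf_option_bool_sum:
  "pmf p (Some True) + pmf p (Some False) + pmf p (None :: bool option) = 1"
proof -
  have U: "(UNIV :: bool option set) = {Some True, Some False, None}"
    by (auto simp: UNIV_option_conv UNIV_bool)
  have "(\<Sum>a\<in>{Some True, Some False, None}. pmf p a) = 1"
    by (rule sum_pmf_eq_1) (simp_all flip: U)
  then show ?thesis by simp
qed

text \<open>The loss is a convex combination of the costs of the two labels and of abstention,
  weighted by the probabilities of \<open>g\<close>.\<close>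

lemma bayes_loss_le:
  "bayes_loss \<gamma> x \<le> lagrangian_loss \<gamma> g x"
proof -
  let ?m = "bayes_loss \<gamma> x"
  have "?m = ?m * pmf (g x) (Some False) + ?m * pmf (g x) (Some True) + ?m * pmf (g x) None"
    using pmf_option_bool_sum[of "g x"] unfolding distrib_left[symmetric] by (simp add: add.commute)
  also have "\<dots> \<le> lagrangian_loss \<gamma> g x"
    unfolding lagrangian_loss_def
    by (intro add_mono mult_right_mono) (auto simp: bayes_loss_def)
  finally show ?thesis .
qed

lemma integrable_losses:
  assumes "measurable_classifier g" "0 \<le> \<gamma>" "\<gamma> \<le> 1/2"
  shows "integrable \<mu> (lagrangian_loss \<gamma> g)" "integrable \<mu> (bayes_loss \<gamma>)"
    "integrable \<mu> (\<lambda>x. pmf (g x) None)"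
    "integrable \<mu> (\<lambda>x. \<eta> x * pmf (g x) (Some False) + (1 - \<eta> x) * pmf (g x) (Some True))"
proof -
  have [measurable]: "\<And>a. (\<lambda>x. pmf (g x) a) \<in> borel_measurable cube_space"
    using assms by (simp add: measurable_classifier_def)
  show n: "integrable \<mu> (\<lambda>x. pmf (g x) None)"
    by (rule integrable_const_bound[where B = 1]) (auto simp: pmf_le_1)
  have e: "integrable \<mu> (\<lambda>x. \<eta> x * pmf (g x) (Some False))" "integrable \<mu> (\<lambda>x. (1 - \<eta> x) * pmf (g x) (Some True))"
    using \<eta>_range
    by (auto intro!: integrable_const_bound[where B = 1] AE_I2 simp: space_\<mu> abs_mult pmf_le_1 mult_le_one)
  then show e': "integrable \<mu> (\<lambda>x. \<eta> x * pmf (g x) (Some False) + (1 - \<eta> x) * pmf (g x) (Some True))"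
    by simp
  show "integrable \<mu> (lagrangian_loss \<gamma> g)"
    unfolding lagrangian_loss_def[abs_def] using n e' by simp
  show "integrable \<mu> (bayes_loss \<gamma>)"
    unfolding bayes_loss_def[abs_def]
  proof (rule integrable_const_bound[where B = 1])
    show "AE x in \<mu>. norm (min (min (\<eta> x) (1 - \<eta> x)) (1 / 2 - \<gamma>)) \<le> 1"
    proof (rule AE_I2)
      fix x assume "x \<in> space \<mu>"
      then show "norm (min (min (\<eta> x) (1 - \<eta> x)) (1 / 2 - \<gamma>)) \<le> 1"
        using \<eta>_range[of x] assms by (auto simp: space_\<mu> min_def)
    qed
  qed measurable
qed

lemma integral_lagrangian_loss:
  assumes "measurable_classifier g" "0 \<le> \<gamma>" "\<gamma> \<le> 1/2"
  shows "(\<integral>x. lagrangian_loss \<gamma> g x \<partial>\<mu>) = risk joint_law g + (1/2 - \<gamma>) * abstention_rate \<mu> g"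
  unfolding risk_joint_law[OF assms(1)] abstention_rate_def lagrangian_loss_def
  using integrable_losses(3,4)[OF assms] by simp

text \<open>Duality: \<open>1/2 - \<gamma>\<close> is the multiplier of the constraint on the abstention rate, and thresholding
  \<open>\<bar>\<eta> - 1/2\<bar>\<close> at \<open>\<gamma>\<close> minimizes the Lagrangian pointwise while exhausting the budget \<open>\<delta>\<close>.\<close>

lemma excess_risk_ge:
  assumes \<gamma>: "0 \<le> \<gamma>" "\<gamma> \<le> 1/2"
    and mass: "measure \<mu> {x \<in> space \<mu>. \<bar>\<eta> x - 1/2\<bar> \<le> \<gamma>} = \<delta>"
    and g: "g \<in> feasible_classifiers \<delta> \<mu>"
  shows "(\<integral>x. lagrangian_loss \<gamma> g x - bayes_loss \<gamma> x \<partial>\<mu>)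
    \<le> risk joint_law g - risk joint_law (bayes_classifier \<delta> joint_law)"
proof -
  \<comment> \<open>Ties go to abstention, so the region of abstention is exactly the set whose mass
    is assumed to be \<delta>.\<close>
  define b where "b x = (if \<bar>\<eta> x - 1/2\<bar> \<le> \<gamma> then return_pmf None else return_pmf (Some (1/2 < \<eta> x)))" for x
  have b: "measurable_classifier b"
    unfolding measurable_classifier_def b_def by measurable
  have pmf_b: "pmf (b x) None = indicator {x \<in> space \<mu>. \<bar>\<eta> x - 1/2\<bar> \<le> \<gamma>} x" if "x \<in> space \<mu>" for x
    using that by (auto simp: b_def indicator_def)
  have "abstention_rate \<mu> b = (\<integral>x. indicator {x \<in> space \<mu>. \<bar>\<eta> x - 1/2\<bar> \<le> \<gamma>} x \<partial>\<mu>)"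
    unfolding abstention_rate_def by (intro Bochner_Integration.integral_cong) (auto simp: pmf_b)
  also have "\<dots> = \<delta>"
    using mass by (simp add: Int_def conj_commute)
  finally have rate_b: "abstention_rate \<mu> b = \<delta>" .
  have "lagrangian_loss \<gamma> b x = bayes_loss \<gamma> x" for x
    using \<gamma> by (auto simp: lagrangian_loss_def bayes_loss_def b_def indicator_def min_def abs_if split: if_splits)
  then have risk_b: "risk joint_law b = (\<integral>x. bayes_loss \<gamma> x \<partial>\<mu>) - (1/2 - \<gamma>) * \<delta>"
    using integral_lagrangian_loss[OF b \<gamma>] rate_b by simp
  have gap: "(\<integral>x. lagrangian_loss \<gamma> g x - bayes_loss \<gamma> x \<partial>\<mu>) \<le> risk joint_law g - risk joint_law b"
    if "g \<in> feasible_classifiers \<delta> \<mu>" for g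
  proof -
    have g: "measurable_classifier g" "abstention_rate \<mu> g \<le> \<delta>"
      using that by (auto simp: feasible_classifiers_def)
    \<comment> \<open>Since the price is nonnegative, the multiplier term of \<open>g\<close> is at
      most that of \<open>b\<close>, which spends the whole budget.\<close>
    have "(1/2 - \<gamma>) * abstention_rate \<mu> g \<le> (1/2 - \<gamma>) * \<delta>"
      using \<gamma> g by (intro mult_left_mono) auto
    then show ?thesis
      using integrable_losses[OF g(1) \<gamma>] integral_lagrangian_loss[OF g(1) \<gamma>] risk_b by simp
  qed
  \<comment> \<open>\<open>arg_min_on\<close> is meaningful only if a minimum exists. The minimizer
    \<open>b\<close> shows that it does and fixes the optimal risk, whichever minimizer is
    selected.\<close>
  have "risk joint_law (bayes_classifier \<delta> joint_law) = risk joint_law b"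
    unfolding bayes_classifier_def arg_min_on_def marginal_joint_law
  proof (rule arg_min_equality[where f = "risk joint_law" and k = b])
    show "b \<in> feasible_classifiers \<delta> \<mu>" using b rate_b by (simp add: feasible_classifiers_def)
    fix g assume g: "g \<in> feasible_classifiers \<delta> \<mu>"
    have "0 \<le> (\<integral>x. lagrangian_loss \<gamma> g x - bayes_loss \<gamma> x \<partial>\<mu>)"
      using bayes_loss_le by (intro integral_nonneg_AE AE_I2) simp
    with gap[OF g] show "risk joint_law b \<le> risk joint_law g" by simp
  qed
  with gap[OF g] show ?thesis by simp
qed

text \<open>The Bochner integral of a function that is not integrable is 0 by convention, so
  integrability in the seed has to be secured before sums over sign patterns pass through the
  integral.\<close>

lemma integrable_expected_excess_risk:
  assumes A: "admissible_learner \<delta> n \<mu> A"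
  defines "e \<equiv> \<lambda>u. measure_pmf.expectation (transcript \<eta> (\<lambda>t. query A t u) n)
      (\<lambda>h. risk joint_law (learned A u h) - risk joint_law (bayes_classifier \<delta> joint_law))"
  shows "integrable (seed_law A) e"
proof -
  interpret U: prob_space "seed_law A" using A by (simp add: admissible_learner_def)
  let ?r = "risk joint_law (bayes_classifier \<delta> joint_law)"
  have sets_U [measurable_cong]: "sets (seed_law A) = sets borel"
    and q: "\<And>t. t < n \<Longrightarrow> (\<lambda>(u, h). query A t u h) \<in> borel \<Otimes>\<^sub>M history_space t \<rightarrow>\<^sub>M cube_space"
    and l [measurable]: "\<And>a. (\<lambda>((u, h), x). pmf (learned A u h x) a)
        \<in> borel_measurable ((borel \<Otimes>\<^sub>M history_space n) \<Otimes>\<^sub>M cube_space)"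
    and feas: "\<And>u h. h \<in> space (history_space n) \<Longrightarrow> learned A u h \<in> feasible_classifiers \<delta> \<mu>"
    using A by (auto simp: admissible_learner_def)
  have cl: "measurable_classifier (learned A u h)" if "h \<in> space (history_space n)" for u h
    using feas[OF that] by (simp add: feasible_classifiers_def)
  let ?N = "borel \<Otimes>\<^sub>M history_space n :: (real \<times> (real ^ 'd) history) measure"
  have [measurable]: "(\<lambda>z. pmf (learned A (fst (fst z)) (snd (fst z)) (snd z)) a) \<in> borel_measurable (?N \<Otimes>\<^sub>M \<mu>)" for a
    using l[of a] by (simp add: case_prod_unfold cong: measurable_cong_sets sets_pair_measure_cong add: sets_\<mu>)
  have "(\<lambda>z. \<integral>x. \<eta> x * pmf (learned A (fst z) (snd z) x) (Some False)
        + (1 - \<eta> x) * pmf (learned A (fst z) (snd z) x) (Some True) \<partial>\<mu>) \<in> borel_measurable ?N"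
    by (intro borel_measurable_lebesgue_integral) (simp add: case_prod_unfold)
  moreover have "risk joint_law (learned A (fst z) (snd z)) =
      (\<integral>x. \<eta> x * pmf (learned A (fst z) (snd z) x) (Some False)
        + (1 - \<eta> x) * pmf (learned A (fst z) (snd z) x) (Some True) \<partial>\<mu>)" if "z \<in> space ?N" for z
    using that by (intro risk_joint_law cl) (auto simp: space_pair_measure)
  ultimately have "(\<lambda>z. risk joint_law (learned A (fst z) (snd z))) \<in> borel_measurable ?N"
    by (simp cong: measurable_cong)
  then have "(\<lambda>z. risk joint_law (learned A (fst z) (snd z)) - ?r) \<in> borel_measurable ?N" by simp
  from measurable_expectation_transcript[where q = "\<lambda>u t. query A t u", OF q this]
  have [measurable]: "e \<in> borel_measurable borel" unfolding e_def by simp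
  show ?thesis
  proof (rule U.integrable_const_bound[where B = "1 + \<bar>?r\<bar>"])
    show "AE u in seed_law A. norm (e u) \<le> 1 + \<bar>?r\<bar>"
    proof (rule AE_I2)
      fix u
      have q_cube: "query A t u h \<in> unit_cube" if "t < n" "h \<in> space (history_space t)" for t h
        using measurable_space[OF q[OF that(1)], of "(u, h)"] that by (simp add: space_pair_measure)
      have sub: "reachable (\<lambda>t. query A t u) n \<subseteq> space (history_space n)"
        using q_cube by (rule reachable_subset_history_space)
      let ?T = "transcript \<eta> (\<lambda>t. query A t u) n"
      have b: "\<bar>risk joint_law (learned A u h) - ?r\<bar> \<le> 1 + \<bar>?r\<bar>" if "h \<in> set_pmf ?T" for h
      proof -
        have "h \<in> space (history_space n)" using that sub set_pmf_transcript by blast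
        from risk_bounds[OF cl[OF this, of u]] show ?thesis by linarith
      qed
      have int: "integrable (measure_pmf ?T) (\<lambda>h. risk joint_law (learned A u h) - ?r)"
        by (rule integrable_measure_pmf_finite) (rule finite_subset[OF set_pmf_transcript finite_reachable])
      have "norm (e u) \<le> measure_pmf.expectation ?T (\<lambda>h. \<bar>risk joint_law (learned A u h) - ?r\<bar>)"
        unfolding e_def real_norm_def by (rule integral_abs_bound)
      also have "\<dots> \<le> 1 + \<bar>?r\<bar>"
        using int b by (intro measure_pmf.integral_le_const) (auto simp: AE_measure_pmf_iff)
      finally show "norm (e u) \<le> 1 + \<bar>?r\<bar>" .
    qed
  qed simp
qed

end

subsection \<open>Hoelder continuous bumps on a grid\<close>

text \<open>With s = a + b, both summands satisfy x/s \<le> (x/s)^\<beta>, and these ratios add up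
  to 1.\<close>

lemma powr_add_le:
  fixes a b \<beta> :: real
  assumes "0 \<le> a" "0 \<le> b" "0 < \<beta>" "\<beta> \<le> 1"
  shows "(a + b) powr \<beta> \<le> a powr \<beta> + b powr \<beta>"
proof (cases "a + b = 0")
  case False
  define s where "s = a + b"
  have s: "0 < s" using False assms by (simp add: s_def)
  have *: "x * (s powr \<beta>) / s \<le> x powr \<beta>" if "0 \<le> x" "x \<le> s" for x
  proof -
    have "x / s \<le> (x / s) powr \<beta>"
      using powr_mono'[of \<beta> 1 "x / s"] that s assms by simp
    then have "x / s * s powr \<beta> \<le> (x / s) powr \<beta> * s powr \<beta>" by (intro mult_right_mono) auto
    then show ?thesis using that s by (simp add: powr_divide)
  qed
  have "s powr \<beta> = a * (s powr \<beta>) / s + b * (s powr \<beta>) / s"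
    unfolding add_divide_distrib[symmetric] distrib_right[symmetric] s_def[symmetric] using s by simp
  then show ?thesis using *[of a] *[of b] assms by (simp add: s_def)
qed (use assms in auto)

lemma abs_powr_diff_le:
  fixes a b \<beta> :: real
  assumes "0 \<le> a" "0 \<le> b" "0 < \<beta>" "\<beta> \<le> 1"
  shows "\<bar>a powr \<beta> - b powr \<beta>\<bar> \<le> \<bar>a - b\<bar> powr \<beta>"
proof -
  have *: "\<bar>a powr \<beta> - b powr \<beta>\<bar> \<le> \<bar>a - b\<bar> powr \<beta>" if "0 \<le> a" "a \<le> b" for a b
    using powr_add_le[of a "b - a" \<beta>] that assms powr_mono2[of \<beta> a b] by simp
  show ?thesis using *[of a b] *[of b a] assms by (cases "a \<le> b") (auto simp: abs_minus_commute)
qed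

lemma mem_unit_cube: "x \<in> (unit_cube :: (real ^ 'd) set) \<longleftrightarrow> (\<forall>i. 0 \<le> x $ i \<and> x $ i \<le> 1)"
  by (simp add: mem_box_cart)

locale hard_family =
  fixes k :: nat and \<beta> :: real and axis :: "'d::finite"
  assumes k: "1 \<le> k" and \<beta>: "0 < \<beta>" "\<beta> \<le> 1"
begin

definition grid :: "(nat ^ 'd) set" where
  "grid = {v. \<forall>j. v $ j < k}"

text \<open>Cells of half-width \<open>radius\<close>, k of them in each direction, fill [0, 1/2]^D.
  The half of the cube beyond 1/2 in direction \<open>axis\<close> stays free for values of \<eta>
  that carry no sign.\<close>

definition radius :: real where
  "radius = 1 / (4 * real k)"

text \<open>A bump of Hoelder exponent \<beta> that vanishes at distance \<open>radius\<close> can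
  reach the order radius^\<beta>. The factor 1/4 keeps \<eta> in [1/4, 3/4] on the cells and makes
  16 height^2 equal to radius^(2\<beta>).\<close>

definition height :: real where
  "height = radius powr \<beta> / 4"

definition centre :: "nat ^ 'd \<Rightarrow> real ^ 'd" where
  "centre v = (\<chi> j. (2 * real (v $ j) + 1) * radius)"

definition bump :: "nat ^ 'd \<Rightarrow> real ^ 'd \<Rightarrow> real" where
  "bump v x = max 0 (height - norm (x - centre v) powr \<beta> / 4)"

text \<open>The baseline is 1/2 where the cells lie and climbs to 1 along \<open>axis\<close>, so
  \<eta> attains every value in [1/2, 1] off the cells. The index set \<open>S\<close> encodes the
  positive signs.\<close>

definition eta :: "(nat ^ 'd) set \<Rightarrow> real ^ 'd \<Rightarrow> real" where
  "eta S x = max (1/2) (x $ axis) + (\<Sum>v\<in>grid. (if v \<in> S then 1 else - 1) * bump v x)"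

lemma radius: "0 < radius" "radius \<le> 1/4" "4 * real k * radius = 1"
  using k by (auto simp: radius_def field_simps)

lemma height: "0 < height" "height \<le> 1/4"
  using radius \<beta> powr_mono2[of \<beta> radius 1] by (auto simp: height_def)

lemma card_grid: "card grid = k ^ CARD('d)"
proof -
  have "bij_betw vec_nth grid ((UNIV :: 'd set) \<rightarrow>\<^sub>E {..<k})"
  proof (rule bij_betw_imageI)
    show "inj_on vec_nth grid" by (auto simp: inj_on_def vec_eq_iff)
    show "vec_nth ` grid = (UNIV :: 'd set) \<rightarrow>\<^sub>E {..<k}"
    proof (intro equalityI subsetI)
      fix f assume "f \<in> (UNIV :: 'd set) \<rightarrow>\<^sub>E {..<k}"
      then have "vec_lambda f \<in> grid" by (auto simp: grid_def)
      then show "f \<in> vec_nth ` grid" by (metis image_eqI vec_lambda_inverse UNIV_I)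
    qed (auto simp: grid_def)
  qed
  then show ?thesis by (simp add: bij_betw_same_card card_funcsetE)
qed

lemma finite_grid [simp]: "finite grid"
  using card_grid k by (intro card_ge_0_finite) simp

lemma grid_nonempty: "grid \<noteq> {}"
  using card_grid k by (metis card.empty power_not_zero not_one_le_zero)

lemma bump_nonneg [simp]: "0 \<le> bump v x"
  by (simp add: bump_def)

lemma bump_le: "bump v x \<le> height"
  using height by (simp add: bump_def)

lemma bump_centre: "bump v (centre v) = height"
  using height by (simp add: bump_def)

lemma bump_support:
  assumes "bump v x \<noteq> 0"
  shows "\<bar>x $ j - centre v $ j\<bar> < radius"
proof -
  have "norm (x - centre v) powr \<beta> < radius powr \<beta>"
    using assms by (simp add: bump_def height_def max_def split: if_splits)
  then have "norm (x - centre v) < radius"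
    using powr_mono2[of \<beta> radius "norm (x - centre v)"] \<beta> radius by linarith
  then show ?thesis
    using component_le_norm_cart[of "x - centre v" j] by simp
qed

text \<open>A bump lives in an open sup-norm ball of radius \<open>radius\<close>, and distinct
  centres differ by at least twice that in some coordinate.\<close>

lemma bump_disjoint:
  assumes "bump v x \<noteq> 0" "bump w x \<noteq> 0"
  shows "v = w"
proof -
  have "v $ j = w $ j" for j
  proof -
    have "\<bar>centre v $ j - centre w $ j\<bar> < 2 * radius"
      using bump_support[OF assms(1), of j] bump_support[OF assms(2), of j] by linarith
    also have "centre v $ j - centre w $ j = 2 * radius * (real (v $ j) - real (w $ j))"
      by (simp add: centre_def algebra_simps)
    finally have "\<bar>real (v $ j) - real (w $ j)\<bar> < 1"
      using radius by (simp add: abs_mult)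
    then show ?thesis by linarith
  qed
  then show ?thesis by (simp add: vec_eq_iff)
qed

lemma centre_bounds:
  assumes "v \<in> grid"
  shows "radius \<le> centre v $ j" "centre v $ j \<le> 1/2 - radius"
proof -
  show "radius \<le> centre v $ j" using radius by (simp add: centre_def)
  have "2 * real (v $ j) + 1 \<le> 2 * real k - 1"
    using assms by (auto simp: grid_def Suc_le_eq dest: spec[of _ j])
  then have "(2 * real (v $ j) + 1) * radius \<le> (2 * real k - 1) * radius"
    using radius by (intro mult_right_mono) auto
  then show "centre v $ j \<le> 1/2 - radius"
    using radius by (simp add: centre_def algebra_simps)
qed

lemma bump_left_half:
  assumes "v \<in> grid" "bump v x \<noteq> 0"
  shows "x $ axis < 1/2"
  using bump_support[OF assms(2), of axis] centre_bounds[OF assms(1), of axis] by linarith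

lemma centre_cube:
  assumes "v \<in> grid"
  shows "centre v \<in> unit_cube"
  unfolding mem_unit_cube
proof
  fix i
  from centre_bounds[OF assms, of i] radius show "0 \<le> centre v $ i \<and> centre v $ i \<le> 1" by linarith
qed

lemma eta_in_cell:
  assumes "v \<in> grid" "bump v x \<noteq> 0"
  shows "eta S x = 1/2 + (if v \<in> S then 1 else - 1) * bump v x"
proof -
  have "(\<Sum>w\<in>grid. (if w \<in> S then 1 else - 1) * bump w x) =
      (\<Sum>w\<in>grid. if w = v then (if v \<in> S then 1 else - 1) * bump v x else 0)"
    by (intro sum.cong refl) (use bump_disjoint[OF assms(2)] in auto)
  also have "\<dots> = (if v \<in> S then 1 else - 1) * bump v x"
    using assms(1) by (subst sum.delta) auto
  finally show ?thesis
    using bump_left_half[OF assms] by (simp add: eta_def)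
qed

lemma eta_outside:
  assumes "\<And>v. v \<in> grid \<Longrightarrow> bump v x = 0"
  shows "eta S x = max (1/2) (x $ axis)"
  unfolding eta_def using assms by simp

lemma eta_centre: "v \<in> grid \<Longrightarrow> eta S (centre v) = 1/2 + (if v \<in> S then height else - height)"
  using eta_in_cell[of v "centre v" S] bump_centre[of v] height by (auto split: if_splits)

text \<open>Diagonal points with t \<ge> 1/2 avoid all cells, so the marginal can put mass at any
  value of \<eta> in [1/2, 1] without regard to the signs.\<close>

lemma eta_vec: "1/2 \<le> t \<Longrightarrow> eta S (vec t) = t"
  using bump_left_half[of _ "vec t"] by (subst eta_outside) force+

lemma eta_range:
  assumes "x \<in> unit_cube"
  shows "0 \<le> eta S x \<and> eta S x \<le> 1"
proof (cases "\<exists>v\<in>grid. bump v x \<noteq> 0")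
  case True
  then obtain v where "v \<in> grid" "bump v x \<noteq> 0" by auto
  then have "eta S x = 1/2 + bump v x \<or> eta S x = 1/2 - bump v x"
    using eta_in_cell[of v x S] by auto
  then show ?thesis using bump_le[of v x] bump_nonneg[of v x] height by linarith
next
  case False
  then show ?thesis
    using assms by (subst (1 2) eta_outside) (auto simp: mem_unit_cube max_def)
qed

lemma eta_flip:
  assumes "S \<subseteq> grid" "v \<in> grid" "v \<notin> S"
  shows "bump v x = 0 \<Longrightarrow> eta S x = eta (insert v S) x"
    and "bump v x \<noteq> 0 \<Longrightarrow>
      \<exists>b. \<bar>b\<bar> \<le> height \<and> eta S x = 1/2 - b \<and> eta (insert v S) x = 1/2 + b"
proof -
  show "bump v x = 0 \<Longrightarrow> eta S x = eta (insert v S) x"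
    unfolding eta_def by (intro arg_cong2[where f = "(+)"] sum.cong refl) auto
  show "\<exists>b. \<bar>b\<bar> \<le> height \<and> eta S x = 1/2 - b \<and> eta (insert v S) x = 1/2 + b" if "bump v x \<noteq> 0"
    using eta_in_cell[OF assms(2) that] assms(3) bump_le[of v x]
    by (intro exI[of _ "bump v x"]) simp
qed

lemma eta_measurable: "eta S \<in> borel_measurable cube_space"
proof -
  have "(\<lambda>x. eta S x) \<in> borel_measurable borel"
    unfolding eta_def bump_def by measurable
  then show ?thesis by (rule measurable_restrict_space1)
qed

lemma bump_hoelder: "\<bar>bump v x - bump v y\<bar> \<le> norm (x - y) powr \<beta>"
proof -
  have "\<bar>bump v x - bump v y\<bar> \<le> \<bar>norm (x - centre v) powr \<beta> - norm (y - centre v) powr \<beta>\<bar>"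
    unfolding bump_def by (auto simp: max_def abs_if)
  also have "\<dots> \<le> \<bar>norm (x - centre v) - norm (y - centre v)\<bar> powr \<beta>"
    by (rule abs_powr_diff_le) (use \<beta> in auto)
  also have "\<dots> \<le> norm (x - y) powr \<beta>"
    using norm_triangle_ineq3[of "x - centre v" "y - centre v"] \<beta> by (intro powr_mono2) auto
  finally show ?thesis .
qed

text \<open>The 3 counts one unit for the baseline and one for each of the at most two bumps that do
  not vanish at \<open>x\<close> or at \<open>y\<close>. The baseline is Lipschitz, and coordinate
  differences in the cube satisfy |t| \<le> |t|^\<beta>.\<close>

lemma eta_hoelder:
  assumes "3 \<le> L"
  shows "hoelder_on_cube L \<beta> (eta S)"
  unfolding hoelder_on_cube_def
proof (intro ballI)
  fix x y :: "real ^ 'd" assume xy: "x \<in> unit_cube" "y \<in> unit_cube"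
  let ?N = "norm (x - y) powr \<beta>"
  have "\<bar>x $ axis - y $ axis\<bar> \<le> \<bar>x $ axis - y $ axis\<bar> powr \<beta>"
  proof -
    have "\<bar>x $ axis - y $ axis\<bar> \<le> 1"
      using xy unfolding mem_unit_cube by (smt (verit))
    then show ?thesis
      using powr_mono'[of \<beta> 1 "\<bar>x $ axis - y $ axis\<bar>"] \<beta> by simp
  qed
  also have "\<dots> \<le> ?N"
    using component_le_norm_cart[of "x - y" axis] \<beta> by (intro powr_mono2) auto
  finally have base: "\<bar>max (1/2) (x $ axis) - max (1/2) (y $ axis)\<bar> \<le> ?N" by linarith
  let ?d = "\<lambda>v. \<bar>bump v x - bump v y\<bar>"
  let ?V = "\<lambda>z. {v\<in>grid. bump v z \<noteq> 0}"
  have cV: "card (?V z) \<le> 1" for z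
    using bump_disjoint[of _ z] by (auto simp: card_le_Suc0_iff_eq)
  have "(\<Sum>v\<in>grid. ?d v) = (\<Sum>v\<in>?V x \<union> ?V y. ?d v)"
    by (intro sum.mono_neutral_right) auto
  also have "\<dots> \<le> (\<Sum>v\<in>?V x \<union> ?V y. ?N)"
    by (intro sum_mono bump_hoelder)
  also have "\<dots> = card (?V x \<union> ?V y) * ?N" by simp
  also have "\<dots> \<le> 2 * ?N"
    using card_Un_le[of "?V x" "?V y"] cV[of x] cV[of y]
    by (intro mult_right_mono) auto
  finally have bumps: "(\<Sum>v\<in>grid. ?d v) \<le> 2 * ?N" .
  have "\<bar>eta S x - eta S y\<bar> = \<bar>(max (1/2) (x $ axis) - max (1/2) (y $ axis)) +
      (\<Sum>v\<in>grid. (if v \<in> S then 1 else - 1) * (bump v x - bump v y))\<bar>"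
    unfolding eta_def by (simp add: right_diff_distrib sum_subtractf)
  also have "\<dots> \<le> ?N + (\<Sum>v\<in>grid. \<bar>(if v \<in> S then 1 else - 1) * (bump v x - bump v y)\<bar>)"
    by (rule order_trans[OF abs_triangle_ineq add_mono[OF base sum_abs]])
  also have "(\<Sum>v\<in>grid. \<bar>(if v \<in> S then 1 else - 1) * (bump v x - bump v y)\<bar>) = (\<Sum>v\<in>grid. ?d v)"
    by (intro sum.cong refl) (simp add: abs_mult)
  also have "?N + \<dots> \<le> 3 * ?N" using bumps by simp
  also have "\<dots> \<le> L * ?N" using assms by (intro mult_right_mono) auto
  finally show "\<bar>eta S x - eta S y\<bar> \<le> L * ?N" .
qed

lemma inj_on_centre: "inj_on centre grid"
  using bump_disjoint bump_centre height by (metis inj_onI less_irrefl)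

end

subsection \<open>The hard distributions\<close>

locale hard_marginal = hard_family k \<beta> axis
  for k :: nat and \<beta> :: real and axis :: "'d::finite" +
  fixes \<delta> \<alpha> :: real
  assumes \<delta>: "0 < \<delta>" "\<delta> < 1" and \<alpha>: "0 < \<alpha>"
begin

definition sampling_space :: "(real \<times> (nat ^ 'd)) measure" where
  "sampling_space = uniform_measure lborel {0..1} \<Otimes>\<^sub>M uniform_count_measure grid"

text \<open>The first component selects the part, so masses become lengths: \<delta> for the atom,
  (1 - \<delta>)/2 for the segment and (1 - \<delta>)/2 for the centres. On the segment,
  u^(1/\<alpha>)/4 is an inverse distribution function: the excess over 1/2 + height/2 is at most t
  with mass (4t)^\<alpha>, as long as the segment lasts.\<close>

definition point :: "real \<times> (nat ^ 'd) \<Rightarrow> real ^ 'd" where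
  "point z = (if fst z \<le> \<delta> then vec (1/2)
     else if fst z \<le> (1 + \<delta>) / 2
       then vec (1/2 + height / 2 + min 1 ((fst z - \<delta>) powr (1 / \<alpha>)) / 4)
     else centre (snd z))"

definition \<mu> :: "(real ^ 'd) measure" where
  "\<mu> = distr sampling_space cube_space point"

lemma prob_space_uniform: "prob_space (uniform_measure lborel {0..1::real})"
  by (rule prob_space_uniform_measure) auto

lemma prob_space_grid: "prob_space (uniform_count_measure grid)"
  by (rule prob_space_uniform_count_measure) (simp_all add: grid_nonempty)

sublocale U: prob_space "uniform_measure lborel {0..1::real}"
  by (rule prob_space_uniform)

sublocale G: prob_space "uniform_count_measure grid"
  by (rule prob_space_grid)

sublocale UG: pair_prob_space "uniform_measure lborel {0..1::real}" "uniform_count_measure grid" ..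

sublocale S: prob_space sampling_space
  unfolding sampling_space_def by unfold_locales

lemma space_sampling: "space sampling_space = UNIV \<times> grid"
  by (simp add: sampling_space_def space_pair_measure space_uniform_count_measure)

lemma point_measurable [measurable]: "point \<in> sampling_space \<rightarrow>\<^sub>M cube_space"
proof (rule measurable_restrict_space2)
  show "point \<in> space sampling_space \<rightarrow> unit_cube"
  proof
    fix z assume "z \<in> space sampling_space"
    then have "centre (snd z) \<in> unit_cube" by (auto simp: space_sampling intro: centre_cube)
    moreover have "vec t \<in> (unit_cube :: (real ^ 'd) set)" if "0 \<le> t" "t \<le> 1" for t
      using that by (simp add: mem_unit_cube)
    ultimately show "point z \<in> unit_cube"
      using height by (auto simp: point_def)
  qed
  have [measurable]: "centre \<in> uniform_count_measure grid \<rightarrow>\<^sub>M borel"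
    by (rule measurableI) (auto simp: space_uniform_count_measure sets_uniform_count_measure)
  have [measurable]: "(vec :: real \<Rightarrow> real ^ 'd) \<in> borel \<rightarrow>\<^sub>M borel"
    by (intro borel_measurable_continuous_onI) (simp add: vec_def continuous_intros)
  show "point \<in> sampling_space \<rightarrow>\<^sub>M borel"
    unfolding point_def sampling_space_def by measurable
qed

lemma sets_\<mu>: "sets \<mu> = sets cube_space"
  by (simp add: \<mu>_def)

lemma prob_space_\<mu>: "prob_space \<mu>"
  unfolding \<mu>_def by (rule S.prob_space_distr) measurable

text \<open>All sign patterns share the marginal \<mu>, so a learner that knows \<mu> knows nothing
  about the signs. Notions of \<open>cube_model\<close> that involve \<eta> take the pattern
  \<open>S\<close> as a leading argument from here on.\<close>

sublocale cube_model \<mu> "eta S" for S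
  by (intro cube_model.intro cube_model_axioms.intro prob_space_\<mu> sets_\<mu> eta_measurable eta_range)

lemma measure_\<mu>:
  assumes "Measurable.pred cube_space P"
  shows "measure \<mu> {x \<in> space \<mu>. P x} = measure sampling_space {z \<in> space sampling_space. P (point z)}"
proof -
  note [measurable] = assms
  have "{x \<in> space cube_space. P x} \<in> sets cube_space" by measurable
  then have "measure \<mu> {x \<in> space \<mu>. P x} =
      measure sampling_space (point -` {x \<in> space cube_space. P x} \<inter> space sampling_space)"
    unfolding \<mu>_def by (simp add: measure_distr[OF point_measurable])
  also have "point -` {x \<in> space cube_space. P x} \<inter> space sampling_space =
      {z \<in> space sampling_space. P (point z)}"
    using measurable_space[OF point_measurable] by auto
  finally show ?thesis .
qed

lemma measure_rectangle:
  assumes "A \<in> sets borel" "B \<subseteq> grid"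
  shows "measure sampling_space (A \<times> B) = measure lborel ({0..1} \<inter> A) * (card B / card grid)"
proof -
  have "measure sampling_space (A \<times> B) =
      measure (uniform_measure lborel {0..1}) A * measure (uniform_count_measure grid) B"
    using assms unfolding sampling_space_def
    by (subst measure_def, subst G.emeasure_pair_measure_Times)
       (simp_all add: sets_uniform_count_measure measure_def enn2real_mult)
  also have "measure (uniform_measure lborel {0..1}) A = measure lborel ({0..1} \<inter> A)"
    using assms by (subst measure_uniform_measure) auto
  also have "measure (uniform_count_measure grid) B = card B / card grid"
    using assms by (simp add: measure_uniform_count_measure)
  finally show ?thesis .
qed

lemma measure_initial:
  assumes "0 \<le> c" "c \<le> 1"
  shows "measure sampling_space ({..c} \<times> grid) = c"
proof -
  have "{0..1} \<inter> {..c} = {0..c}" using assms by auto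
  then show ?thesis
    using assms grid_nonempty by (simp add: measure_rectangle)
qed

lemma point_cases:
  assumes "z \<in> space sampling_space"
  obtains (atom) "fst z \<le> \<delta>" "eta S (point z) = 1/2"
  | (curve) "\<delta> < fst z" "fst z \<le> (1 + \<delta>) / 2"
      "eta S (point z) = 1/2 + height / 2 + (fst z - \<delta>) powr (1 / \<alpha>) / 4"
  | (hard) "(1 + \<delta>) / 2 < fst z" "eta S (point z) = 1/2 + height \<or> eta S (point z) = 1/2 - height"
proof -
  consider "fst z \<le> \<delta>" | "\<delta> < fst z" "fst z \<le> (1 + \<delta>) / 2" | "(1 + \<delta>) / 2 < fst z" "\<delta> < fst z"
    using \<delta> by fastforce
  then show thesis
  proof cases
    case 1
    then show thesis using atom eta_vec[of "1/2" S] by (simp add: point_def)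
  next
    case 2
    have "(fst z - \<delta>) powr (1 / \<alpha>) \<le> 1 powr (1 / \<alpha>)"
      using 2 \<delta> \<alpha> by (intro powr_mono2) auto
    then show thesis using 2 curve height by (simp add: point_def eta_vec)
  next
    case 3
    have "snd z \<in> grid" using assms by (auto simp: space_sampling)
    with 3 show thesis using hard by (auto simp: point_def eta_centre)
  qed
qed

section \<open>Position of the threshold and the margin assumption\<close>

lemma powr_inverse_le_iff:
  assumes "0 < u" "0 \<le> t"
  shows "u powr (1 / \<alpha>) / 4 \<le> t \<longleftrightarrow> u \<le> (4 * t) powr \<alpha>"
proof
  assume "u powr (1 / \<alpha>) / 4 \<le> t"
  then have "(u powr (1 / \<alpha>)) powr \<alpha> \<le> (4 * t) powr \<alpha>"
    using \<alpha> by (intro powr_mono2) auto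
  then show "u \<le> (4 * t) powr \<alpha>" using \<alpha> assms by (simp add: powr_powr)
next
  assume "u \<le> (4 * t) powr \<alpha>"
  then have "u powr (1 / \<alpha>) \<le> ((4 * t) powr \<alpha>) powr (1 / \<alpha>)"
    using \<alpha> assms by (intro powr_mono2) auto
  then show "u powr (1 / \<alpha>) / 4 \<le> t" using \<alpha> assms by (simp add: powr_powr)
qed

text \<open>Only the atom lies this close to 1/2: the segment starts strictly beyond height/2 and
  the centres are at distance \<open>height\<close>. The endpoint \<gamma> = height/2 is included
  because the duality argument asks for mass exactly \<delta> there.\<close>

lemma mass_below_threshold:
  assumes "0 \<le> \<gamma>" "\<gamma> \<le> height / 2"
  shows "measure \<mu> {x \<in> space \<mu>. \<bar>eta S x - 1/2\<bar> \<le> \<gamma>} = \<delta>"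
proof -
  have "{z \<in> space sampling_space. \<bar>eta S (point z) - 1/2\<bar> \<le> \<gamma>} = {..\<delta>} \<times> grid"
  proof (intro equalityI subsetI)
    fix z assume z: "z \<in> {z \<in> space sampling_space. \<bar>eta S (point z) - 1/2\<bar> \<le> \<gamma>}"
    then have zs: "z \<in> space sampling_space" by simp
    then have "fst z \<le> \<delta>"
    proof (cases rule: point_cases[where S = S])
      case curve
      then have "0 < (fst z - \<delta>) powr (1 / \<alpha>)" by simp
      with curve z assms show ?thesis by auto
    next
      case hard
      then show ?thesis using z assms height by auto
    qed
    then show "z \<in> {..\<delta>} \<times> grid" using zs by (auto simp: space_sampling mem_Times_iff)
  next
    fix z assume z: "z \<in> {..\<delta>} \<times> grid"
    then have "z \<in> space sampling_space" by (auto simp: space_sampling)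
    then show "z \<in> {z \<in> space sampling_space. \<bar>eta S (point z) - 1/2\<bar> \<le> \<gamma>}"
    proof (cases rule: point_cases[where S = S])
      case atom
      then show ?thesis using \<open>z \<in> space sampling_space\<close> assms by simp
    qed (use z \<delta> in auto)
  qed
  then show ?thesis
    using \<delta> eta_measurable[of S] by (subst measure_\<mu>) (simp_all add: measure_initial)
qed

lemma mass_above_threshold:
  assumes "height / 2 < \<gamma>"
  shows "\<delta> < measure \<mu> {x \<in> space \<mu>. \<bar>eta S x - 1/2\<bar> \<le> \<gamma>}"
proof -
  \<comment> \<open>The length of the part of the segment's parameter interval caught by \<gamma>,
    capped by its total length. It is positive for every \<gamma> > height/2, which makes height/2
    the supremum.\<close>
  define c where "c = min ((1 - \<delta>) / 2) ((4 * (\<gamma> - height / 2)) powr \<alpha>)"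
  have c: "0 < c" "c \<le> (1 - \<delta>) / 2" "c \<le> (4 * (\<gamma> - height / 2)) powr \<alpha>"
    using assms \<delta> min.cobounded1[of "(1 - \<delta>) / 2"] min.cobounded2[of "(1 - \<delta>) / 2"]
    unfolding c_def by simp_all
  have "{..\<delta> + c} \<times> grid \<subseteq> {z \<in> space sampling_space. \<bar>eta S (point z) - 1/2\<bar> \<le> \<gamma>}"
  proof
    fix z assume z: "z \<in> {..\<delta> + c} \<times> grid"
    then have zs: "z \<in> space sampling_space" by (auto simp: space_sampling)
    have "\<bar>eta S (point z) - 1/2\<bar> \<le> \<gamma>"
      using zs
    proof (cases rule: point_cases[where S = S])
      case curve
      have "(fst z - \<delta>) powr (1 / \<alpha>) / 4 \<le> \<gamma> - height / 2"
        using z curve c assms by (subst powr_inverse_le_iff) auto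
      moreover have "0 \<le> (fst z - \<delta>) powr (1 / \<alpha>)" by simp
      ultimately show ?thesis using curve height by linarith
    next
      case hard
      then show ?thesis using z c \<delta> by (auto simp: field_simps)
    qed (use assms height in simp)
    with zs show "z \<in> {z \<in> space sampling_space. \<bar>eta S (point z) - 1/2\<bar> \<le> \<gamma>}" by simp
  qed
  then have "measure sampling_space ({..\<delta> + c} \<times> grid) \<le>
      measure sampling_space {z \<in> space sampling_space. \<bar>eta S (point z) - 1/2\<bar> \<le> \<gamma>}"
    using eta_measurable[of S] by (intro S.finite_measure_mono) measurable
  moreover have "measure sampling_space ({..\<delta> + c} \<times> grid) = \<delta> + c"
    using c \<delta> by (intro measure_initial) auto
  ultimately show ?thesis
    using c eta_measurable[of S] by (subst measure_\<mu>) simp_all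
qed

lemma threshold: "abstention_threshold \<delta> \<mu> (eta S) = height / 2"
proof -
  have "insert 0 {\<gamma>. 0 \<le> \<gamma> \<and> measure \<mu> {x \<in> space \<mu>. \<bar>eta S x - 1/2\<bar> \<le> \<gamma>} \<le> \<delta>} = {0..height / 2}"
  proof (intro equalityI subsetI)
    fix \<gamma> assume "\<gamma> \<in> insert 0 {\<gamma>. 0 \<le> \<gamma> \<and> measure \<mu> {x \<in> space \<mu>. \<bar>eta S x - 1/2\<bar> \<le> \<gamma>} \<le> \<delta>}"
    then show "\<gamma> \<in> {0..height / 2}"
      using mass_above_threshold[of \<gamma> S] height by force
  qed (use mass_below_threshold in auto)
  then show ?thesis
    unfolding abstention_threshold_def using height by simp
qed

text \<open>The constant of the margin assumption may depend on the distribution, here through \<open>height\<close>;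
  so only the mass arbitrarily close to the thresholds matters.\<close>

lemma margin: "margin_assumption \<alpha> \<delta> \<mu> (eta S)"
  unfolding margin_assumption_def threshold
proof (intro exI[of _ "4 powr \<alpha> + (2 / height) powr \<alpha>"] conjI allI impI ballI)
  show "0 < 4 powr \<alpha> + (2 / height) powr \<alpha>" using height by (intro add_pos_pos) auto
  fix t \<gamma> :: real
  assume t: "0 < t \<and> t \<le> 1" and \<gamma>: "\<gamma> \<in> {1/2 - height / 2, 1/2 + height / 2}"
  let ?m = "measure \<mu> {x \<in> space \<mu>. \<bar>eta S x - \<gamma>\<bar> \<le> t}"
  show "?m \<le> (4 powr \<alpha> + (2 / height) powr \<alpha>) * t powr \<alpha>"
  \<comment> \<open>Below height/2, the atom and the centres are too far from both thresholds and
    only the segment near 1/2 + height/2 is left. From height/2 on, the trivial bound 1 is absorbed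
    by the second constant, as (2t / height)^\<alpha> \<ge> 1.\<close>
  proof (cases "t < height / 2")
    case True
    have "{z \<in> space sampling_space. \<bar>eta S (point z) - \<gamma>\<bar> \<le> t} \<subseteq> {\<delta>..\<delta> + (4 * t) powr \<alpha>} \<times> grid"
    proof
      fix z assume z: "z \<in> {z \<in> space sampling_space. \<bar>eta S (point z) - \<gamma>\<bar> \<le> t}"
      then have zs: "z \<in> space sampling_space" and close: "\<bar>eta S (point z) - \<gamma>\<bar> \<le> t" by auto
      from zs have "\<delta> \<le> fst z \<and> fst z \<le> \<delta> + (4 * t) powr \<alpha>"
      proof (cases rule: point_cases[where S = S])
        case atom
        then show ?thesis using close \<gamma> True height by (auto simp: abs_if split: if_splits)
      next
        case curve
        have "0 \<le> (fst z - \<delta>) powr (1 / \<alpha>)" by simp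
        then have "(fst z - \<delta>) powr (1 / \<alpha>) / 4 \<le> t"
          using close \<gamma> True height curve by (auto simp: abs_if split: if_splits)
        then have "fst z - \<delta> \<le> (4 * t) powr \<alpha>"
          using curve t by (subst (asm) powr_inverse_le_iff) auto
        then show ?thesis using curve by simp
      next
        case hard
        then show ?thesis using close \<gamma> True height by (auto simp: abs_if split: if_splits)
      qed
      then show "z \<in> {\<delta>..\<delta> + (4 * t) powr \<alpha>} \<times> grid"
        using zs by (auto simp: space_sampling mem_Times_iff)
    qed
    then have "measure sampling_space {z \<in> space sampling_space. \<bar>eta S (point z) - \<gamma>\<bar> \<le> t}
        \<le> measure sampling_space ({\<delta>..\<delta> + (4 * t) powr \<alpha>} \<times> grid)"
      by (rule S.finite_measure_mono)
         (auto simp: sampling_space_def sets_uniform_count_measure intro!: pair_measureI)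
    also have "\<dots> = measure lborel ({0..1} \<inter> {\<delta>..\<delta> + (4 * t) powr \<alpha>})"
      using grid_nonempty by (simp add: measure_rectangle)
    also have "\<dots> \<le> measure lborel {\<delta>..\<delta> + (4 * t) powr \<alpha>}"
      by (intro measure_mono_fmeasurable) (auto simp: fmeasurable_def)
    also have "\<dots> = 4 powr \<alpha> * t powr \<alpha>"
      using t by (simp add: powr_mult)
    finally have "?m \<le> 4 powr \<alpha> * t powr \<alpha>"
      using eta_measurable[of S] by (subst measure_\<mu>) simp_all
    also have "\<dots> \<le> (4 powr \<alpha> + (2 / height) powr \<alpha>) * t powr \<alpha>"
      by (intro mult_right_mono) auto
    finally show ?thesis .
  next
    case False
    have "?m \<le> 1 powr \<alpha>" by simp
    also have "\<dots> \<le> (2 / height * t) powr \<alpha>"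
      using False height \<alpha> by (intro powr_mono2) (auto simp: field_simps)
    also have "\<dots> = (2 / height) powr \<alpha> * t powr \<alpha>"
      using t height by (intro powr_mult)
    also have "\<dots> \<le> (4 powr \<alpha> + (2 / height) powr \<alpha>) * t powr \<alpha>"
      by (intro mult_right_mono) auto
    finally show ?thesis .
  qed
qed

lemma joint_law_in_model_class:
  assumes "3 \<le> L"
  shows "(joint_law S, eta S) \<in> model_class \<delta> L \<beta> \<alpha>"
  using joint_distribution_joint_law regression_function_joint_law eta_hoelder[OF assms] margin
  by (simp add: model_class_def marginal_joint_law)

section \<open>Regret collected at the centres\<close>

lemma mass_centre:
  assumes v: "v \<in> grid"
  shows "(1 - \<delta>) / (2 * card grid) \<le> measure \<mu> {centre v}"
proof -
  have sgl: "{centre v} = {x \<in> space \<mu>. x = centre v}"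
    using centre_cube[OF v] by (auto simp: space_\<mu>)
  have pred: "Measurable.pred cube_space (\<lambda>x. x = centre v)"
    by (rule measurable_restrict_space1) measurable
  have "{0..1} \<inter> {(1 + \<delta>) / 2<..} = {(1 + \<delta>) / 2<..1}" using \<delta> by auto
  then have "(1 - \<delta>) / (2 * card grid) = measure sampling_space ({(1 + \<delta>) / 2<..} \<times> {v})"
    using v \<delta> by (simp add: measure_rectangle field_simps)
  also have "\<dots> \<le> measure sampling_space {z \<in> space sampling_space. point z = centre v}"
  proof (rule S.finite_measure_mono)
    show "{(1 + \<delta>) / 2<..} \<times> {v} \<subseteq> {z \<in> space sampling_space. point z = centre v}"
      using v \<delta> by (auto simp: space_sampling point_def)
    show "{z \<in> space sampling_space. point z = centre v} \<in> sets sampling_space"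
      using measurable_compose[OF point_measurable pred] by (rule predE)
  qed
  also have "\<dots> = measure \<mu> {centre v}"
    unfolding sgl by (rule measure_\<mu>[symmetric, OF pred])
  finally show ?thesis .
qed

text \<open>Nonnegativity allows dropping everything off the centres, which are pairwise distinct
  atoms.\<close>

lemma integral_ge_centres:
  fixes f :: "real ^ 'd \<Rightarrow> real"
  assumes f: "integrable \<mu> f" and nn: "\<And>x. 0 \<le> f x"
  shows "(1 - \<delta>) / (2 * card grid) * (\<Sum>v\<in>grid. f (centre v)) \<le> (\<integral>x. f x \<partial>\<mu>)"
proof -
  have sgl [measurable]: "{centre v} \<in> sets \<mu>" if "v \<in> grid" for v
    unfolding sets_\<mu> using centre_cube[OF that] by (subst sets_restrict_space_iff) auto
  have int: "integrable \<mu> (\<lambda>x. indicator {centre v} x * f (centre v))" if "v \<in> grid" for v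
    using sgl[OF that] by (auto intro!: integrable_real_mult_indicator simp: emeasure_eq_measure)
  have "(1 - \<delta>) / (2 * card grid) * (\<Sum>v\<in>grid. f (centre v)) \<le> (\<Sum>v\<in>grid. measure \<mu> {centre v} * f (centre v))"
    unfolding sum_distrib_left by (intro sum_mono mult_right_mono mass_centre nn)
  also have "\<dots> = (\<Sum>v\<in>grid. \<integral>x. indicator {centre v} x * f (centre v) \<partial>\<mu>)"
    using centre_cube by (intro sum.cong refl) (simp add: space_\<mu> Int_absorb2)
  also have "\<dots> = (\<integral>x. (\<Sum>v\<in>grid. indicator {centre v} x * f (centre v)) \<partial>\<mu>)"
    by (rule Bochner_Integration.integral_sum[symmetric]) (rule int)
  also have "\<dots> \<le> (\<integral>x. f x \<partial>\<mu>)"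
  proof (rule integral_mono)
    fix x
    show "(\<Sum>v\<in>grid. indicator {centre v} x * f (centre v)) \<le> f x"
    proof (cases "x \<in> centre ` grid")
      case True
      then obtain w where w: "w \<in> grid" "x = centre w" by auto
      have "(\<Sum>v\<in>grid. indicator {centre v} x * f (centre v)) = (\<Sum>v\<in>grid. if v = w then f x else 0)"
        using w inj_on_centre by (intro sum.cong refl) (auto simp: indicator_def inj_on_def)
      then show ?thesis using w by simp
    next
      case False
      then have "(\<Sum>v\<in>grid. indicator {centre v} x * f (centre v)) = 0"
        by (intro sum.neutral) (auto simp: indicator_def)
      then show ?thesis using nn by simp
    qed
  qed (rule Bochner_Integration.integrable_sum, rule int, assumption, rule f)
  finally show ?thesis .
qed

text \<open>The excess over the Bayes loss 1/2 - height at a centre with sign \<open>y\<close>: the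
  wrong label costs 1/2 + height, abstention 1/2 - height/2.\<close>

definition centre_loss :: "(real ^ 'd) abstaining_classifier \<Rightarrow> nat ^ 'd \<Rightarrow> bool \<Rightarrow> real" where
  "centre_loss g v y = 2 * height * pmf (g (centre v)) (Some (\<not> y)) + height / 2 * pmf (g (centre v)) None"

lemma centre_loss_nonneg: "0 \<le> centre_loss g v y"
  using height by (simp add: centre_loss_def)

text \<open>Abstaining is no escape: with abstention probability a, the sum is height * (2 - a),
  smallest for a = 1.\<close>

lemma centre_loss_sum: "height \<le> centre_loss g v True + centre_loss g v False"
proof -
  have None: "pmf (g (centre v)) None = 1 - pmf (g (centre v)) (Some True) - pmf (g (centre v)) (Some False)"
    using pmf_option_bool_sum[of "g (centre v)"] by simp
  have "centre_loss g v True + centre_loss g v False = height +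
      height * (pmf (g (centre v)) (Some True) + pmf (g (centre v)) (Some False))"
    by (simp add: centre_loss_def None algebra_simps)
  then show ?thesis using height by simp
qed

lemma excess_risk_ge_centre_loss:
  assumes g: "g \<in> feasible_classifiers \<delta> \<mu>"
  shows "(1 - \<delta>) / (2 * card grid) * (\<Sum>v\<in>grid. centre_loss g v (v \<in> S))
    \<le> risk (joint_law S) g - risk (joint_law S) (bayes_classifier \<delta> (joint_law S))"
proof -
  have g': "measurable_classifier g" using g by (simp add: feasible_classifiers_def)
  have \<gamma>: "0 \<le> height / 2" "height / 2 \<le> 1/2" using height by auto
  let ?f = "\<lambda>x. lagrangian_loss S (height / 2) g x - bayes_loss S (height / 2) x"
  have "centre_loss g v (v \<in> S) = ?f (centre v)" if v: "v \<in> grid" for v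
  proof -
    have "bayes_loss S (height / 2) (centre v) = 1/2 - height"
      using height by (simp add: bayes_loss_def eta_centre[OF v])
    moreover have None: "pmf (g (centre v)) None = 1 - pmf (g (centre v)) (Some True) - pmf (g (centre v)) (Some False)"
      using pmf_option_bool_sum[of "g (centre v)"] by simp
    ultimately show ?thesis
      by (simp add: centre_loss_def lagrangian_loss_def eta_centre[OF v] None algebra_simps)
  qed
  then have "(1 - \<delta>) / (2 * card grid) * (\<Sum>v\<in>grid. centre_loss g v (v \<in> S)) =
      (1 - \<delta>) / (2 * card grid) * (\<Sum>v\<in>grid. ?f (centre v))" by simp
  also have "\<dots> \<le> (\<integral>x. ?f x \<partial>\<mu>)"
    using integrable_losses[OF g' \<gamma>] bayes_loss_le
    by (intro integral_ge_centres) auto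
  also have "\<dots> \<le> risk (joint_law S) g - risk (joint_law S) (bayes_classifier \<delta> (joint_law S))"
    using \<gamma> mass_below_threshold[of "height / 2" S] g by (intro excess_risk_ge) auto
  finally show ?thesis .
qed

end

subsection \<open>Lower bound\<close>

text \<open>The hard pattern depends on the learner and is found by averaging over all patterns. The
  factor 1/12 is the 1/6 of the averaged loss times the 1/2 in the mass (1 - \<delta>)/2 of the
  centres.\<close>

lemma (in hard_marginal) exists_hard_instance:
  assumes A: "admissible_learner \<delta> n \<mu> A" and n: "16 * height\<^sup>2 * n \<le> card grid"
  shows "\<exists>S. (1 - \<delta>) * height / 12 \<le> expected_excess_risk \<delta> n (joint_law S) (eta S) A"
proof -
  interpret V: prob_space "seed_law A" using A by (simp add: admissible_learner_def)
  define c where "c = (1 - \<delta>) / (2 * card grid)"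
  define T where "T S u = transcript (eta S) (\<lambda>t. query A t u) n" for S u
  define e where "e S u = measure_pmf.expectation (T S u)
      (\<lambda>h. risk (joint_law S) (learned A u h) - risk (joint_law S) (bayes_classifier \<delta> (joint_law S)))" for S u
  have card_pos: "0 < card grid" using grid_nonempty by (simp add: card_gt_0_iff)
  have c: "0 \<le> c" using \<delta> by (simp add: c_def)
  have int: "integrable (seed_law A) (e S)" for S
    unfolding e_def[abs_def] T_def by (rule integrable_expected_excess_risk[OF A])
  \<comment> \<open>For a fixed seed the queries are deterministic functions of the past, so the
    finite Assouad bound applies; the seed is integrated out afterwards.\<close>
  have pointwise: "2 ^ card grid * ((1 - \<delta>) * height / 12) \<le> (\<Sum>S\<in>Pow grid. e S u)" for u
  proof -
    let ?q = "\<lambda>t. query A t u"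
    have q_cube: "?q t h \<in> unit_cube" if "t < n" "h \<in> space (history_space t)" for t h
    proof -
      have "(\<lambda>(u, h). query A t u h) \<in> borel \<Otimes>\<^sub>M history_space t \<rightarrow>\<^sub>M cube_space"
        using A that by (simp add: admissible_learner_def)
      from measurable_space[OF this, of "(u, h)"] that show ?thesis by (simp add: space_pair_measure)
    qed
    have reach: "reachable ?q t \<subseteq> space (history_space t)" if "t \<le> n" for t
      using that q_cube by (intro reachable_subset_history_space) auto
    have feas: "learned A u h \<in> feasible_classifiers \<delta> \<mu>" if "h \<in> reachable ?q n" for h
      using A reach[of n] that by (auto simp: admissible_learner_def)
    have "height * 2 ^ card grid * card grid / 6 \<le> (\<Sum>S\<in>Pow grid. measure_pmf.expectation (T S u)
        (\<lambda>h. \<Sum>v\<in>grid. centre_loss (learned A u h) v (v \<in> S)))"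
      unfolding T_def
    proof (rule assouad_transcript[where X = unit_cube and c = "\<lambda>v x. bump v x \<noteq> 0" and \<epsilon> = height])
      show "?q t h \<in> unit_cube" if "t < n" "h \<in> reachable ?q t" for t h
        using that q_cube reach[of t] by auto
    qed (use n height eta_range eta_flip bump_disjoint centre_loss_nonneg centre_loss_sum in auto)
    then have "c * (height * 2 ^ card grid * card grid / 6) \<le> c * (\<Sum>S\<in>Pow grid. measure_pmf.expectation (T S u)
        (\<lambda>h. \<Sum>v\<in>grid. centre_loss (learned A u h) v (v \<in> S)))"
      using c by (rule mult_left_mono)
    also have "\<dots> = (\<Sum>S\<in>Pow grid. measure_pmf.expectation (T S u)
        (\<lambda>h. c * (\<Sum>v\<in>grid. centre_loss (learned A u h) v (v \<in> S))))"
      unfolding integral_mult_right_zero by (rule sum_distrib_left)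
    also have "\<dots> \<le> (\<Sum>S\<in>Pow grid. e S u)"
    proof (rule sum_mono)
      fix S
      have supp: "set_pmf (T S u) \<subseteq> reachable ?q n"
        unfolding T_def by (rule set_pmf_transcript)
      then have fin: "finite (set_pmf (T S u))" by (rule finite_subset) simp
      show "measure_pmf.expectation (T S u) (\<lambda>h. c * (\<Sum>v\<in>grid. centre_loss (learned A u h) v (v \<in> S))) \<le> e S u"
        unfolding e_def
        using supp feas excess_risk_ge_centre_loss[of _ S]
        by (intro integral_mono_AE integrable_measure_pmf_finite fin)
           (auto simp: AE_measure_pmf_iff c_def)
    qed
    also have "c * (height * 2 ^ card grid * card grid / 6) = 2 ^ card grid * ((1 - \<delta>) * height / 12)"
    proof -
      have "d / (2 * m) * (h * p * m / 6) = p * (d * h / 12)" if "0 < m" for d h m p :: real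
        using that by simp
      from this[of "card grid"] show ?thesis using card_pos unfolding c_def by simp
    qed
    finally show ?thesis .
  qed
  have "(\<Sum>S\<in>Pow grid. (1 - \<delta>) * height / 12) \<le> (\<integral>u. (\<Sum>S\<in>Pow grid. e S u) \<partial>seed_law A)"
    using pointwise int by (intro V.integral_ge_const) (auto simp: card_Pow)
  also have "\<dots> = (\<Sum>S\<in>Pow grid. \<integral>u. e S u \<partial>seed_law A)"
    using int by (rule Bochner_Integration.integral_sum)
  finally have "\<exists>S\<in>Pow grid. (1 - \<delta>) * height / 12 \<le> (\<integral>u. e S u \<partial>seed_law A)"
    using sum_strict_mono[of "Pow grid" "\<lambda>S. \<integral>u. e S u \<partial>seed_law A" "\<lambda>_. (1 - \<delta>) * height / 12"]
    by (force simp: not_le)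
  then show ?thesis
    by (auto simp: expected_excess_risk_def e_def[abs_def] T_def)
qed

theorem corollary1:
  fixes \<delta> \<alpha>\<^sub>0 \<beta> L :: real
  assumes "0 < \<delta>" "\<delta> < 1" and "0 < \<alpha>\<^sub>0" and "0 < \<beta>" "\<beta> \<le> 1" and "3 \<le> L"
  shows "\<exists>C>0. \<forall>n\<ge>1.
    (INF \<A> \<in> active_algorithms \<delta> n.
       SUP (P, \<eta>) \<in> (model_class \<delta> L \<beta> \<alpha>\<^sub>0 ::
           (((real ^ 'd) \<times> bool) measure \<times> (real ^ 'd \<Rightarrow> real)) set).
         ereal (expected_excess_risk \<delta> n P \<eta> (\<A> (marginal P))))
    \<ge> ereal (C * real n powr (- (\<beta> * (1 + \<alpha>\<^sub>0) / (2 * \<beta> + real CARD('d)))))"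
proof (intro exI[of _ "(1 - \<delta>) / 12 * (8 powr - \<beta> / 4)"] conjI allI impI INF_greatest)
  \<comment> \<open>The factor (1 - \<delta>)/12 comes from the hard instance, 1/4 from
    \<open>height\<close>, and 8^-\<beta> from radius = 1/(4k) \<ge> 1/(8\<rho>).\<close>
  let ?C = "(1 - \<delta>) / 12 * (8 powr - \<beta> / 4)"
  show "0 < ?C" using assms by simp
  fix n :: nat and \<A> :: "(real ^ 'd) measure \<Rightarrow> (real ^ 'd) learner"
  assume n: "1 \<le> n" and \<A>: "\<A> \<in> active_algorithms \<delta> n"
  define s where "s = 2 * \<beta> + real CARD('d)"
  define \<rho> where "\<rho> = real n powr (1 / s)"
  \<comment> \<open>The smallest k with n \<le> k^(2\<beta>+D). This keeps 16 height^2 n, at most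
    k^(-2\<beta>) n, below the number k^D of cells. Rounding up costs at most a factor 2, as \<rho>
    \<ge> 1.\<close>
  define k where "k = nat \<lceil>\<rho>\<rceil>"
  have s: "0 < s" using assms by (simp add: s_def add_pos_nonneg)
  have \<rho>: "1 \<le> \<rho>" using n s by (simp add: \<rho>_def ge_one_powr_ge_zero)
  then have k_bounds: "1 \<le> k" "\<rho> \<le> real k" "real k \<le> 2 * \<rho>" unfolding k_def by linarith+
  \<comment> \<open>Any coordinate can serve as the distinguished axis; \<open>undefined\<close>
    just names one.\<close>
  interpret hard_marginal k \<beta> "undefined :: 'd" \<delta> \<alpha>\<^sub>0
    by unfold_locales (use assms k_bounds in auto)
  have "real n = \<rho> powr s"
    using n s by (simp add: \<rho>_def powr_powr)
  also have "\<dots> \<le> real k powr s"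
    using \<rho> k_bounds s by (intro powr_mono2) auto
  also have "\<dots> = real k powr (2 * \<beta>) * real k ^ CARD('d)"
    using k_bounds by (simp add: s_def powr_add powr_realpow)
  finally have n_le: "real n \<le> real k powr (2 * \<beta>) * real k ^ CARD('d)" .
  have "16 * height\<^sup>2 = radius powr (2 * \<beta>)"
    by (simp add: height_def power2_eq_square powr_add[symmetric])
  also have "\<dots> \<le> (1 / real k) powr (2 * \<beta>)"
    using assms k_bounds by (intro powr_mono2) (auto simp: radius_def field_simps)
  also have "\<dots> = 1 / real k powr (2 * \<beta>)" using k_bounds by (simp add: powr_divide)
  finally have "16 * height\<^sup>2 * n \<le> 1 / real k powr (2 * \<beta>) * (real k powr (2 * \<beta>) * real k ^ CARD('d))"
    using n_le by (intro mult_mono) auto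
  also have "\<dots> = card grid" using k_bounds by (simp add: card_grid)
  finally have budget: "16 * height\<^sup>2 * n \<le> card grid" .
  \<comment> \<open>Since \<mu> does not depend on the signs, one learner faces all patterns, and
    \<open>S\<close> may be chosen after it.\<close>
  have "admissible_learner \<delta> n \<mu> (\<A> \<mu>)"
    using \<A> prob_space_\<mu> sets_\<mu> by (simp add: active_algorithms_def)
  from exists_hard_instance[OF this budget] obtain S
    where S: "(1 - \<delta>) * height / 12 \<le> expected_excess_risk \<delta> n (joint_law S) (eta S) (\<A> \<mu>)" by auto
  \<comment> \<open>The claimed rate enters here: for n \<ge> 1 the factor 1 +
    \<open>\<alpha>\<^sub>0\<close> in the exponent only makes the bound smaller.\<close>
  have "8 powr - \<beta> * real n powr - (\<beta> * (1 + \<alpha>\<^sub>0) / s) \<le> 8 powr - \<beta> * real n powr - (\<beta> / s)"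
    using n assms s by (intro mult_left_mono powr_mono le_imp_neg_le divide_right_mono) auto
  also have "real n powr - (\<beta> / s) = \<rho> powr - \<beta>"
    using n by (simp add: \<rho>_def powr_powr)
  also have "8 powr - \<beta> * \<rho> powr - \<beta> = (8 * \<rho>) powr - \<beta>"
    by (subst powr_mult) (use \<rho> in auto)
  also have "\<dots> \<le> (4 * real k) powr - \<beta>"
    using \<rho> k_bounds assms by (intro powr_mono2') auto
  also have "\<dots> = radius powr \<beta>"
    unfolding radius_def powr_minus_divide by (subst powr_divide) (use k_bounds in auto)
  finally have "(1 - \<delta>) / 48 * (8 powr - \<beta> * real n powr - (\<beta> * (1 + \<alpha>\<^sub>0) / s))
      \<le> (1 - \<delta>) / 48 * radius powr \<beta>"
    by (rule mult_left_mono) (use assms in auto)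
  also have "\<dots> = (1 - \<delta>) * height / 12" by (simp add: height_def)
  also note S
  finally have "?C * real n powr - (\<beta> * (1 + \<alpha>\<^sub>0) / s)
      \<le> expected_excess_risk \<delta> n (joint_law S) (eta S) (\<A> \<mu>)"
    by (simp add: mult.assoc)
  moreover have "(joint_law S, eta S) \<in> model_class \<delta> L \<beta> \<alpha>\<^sub>0"
    using assms by (intro joint_law_in_model_class)
  ultimately show "ereal (?C * real n powr - (\<beta> * (1 + \<alpha>\<^sub>0) / (2 * \<beta> + real CARD('d))))
      \<le> (SUP (P, \<eta>) \<in> (model_class \<delta> L \<beta> \<alpha>\<^sub>0 ::
           (((real ^ 'd) \<times> bool) measure \<times> (real ^ 'd \<Rightarrow> real)) set).
         ereal (expected_excess_risk \<delta> n P \<eta> (\<A> (marginal P))))"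
    by (intro SUP_upper2[where i = "(joint_law S, eta S)"]) (auto simp: marginal_joint_law s_def)
qed

end
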